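(* Let $A$ be a noetherian ring containing $\mathbb{Q}$, with finite integral degree $\mathrm{d}_{A}(\overline{A})=d$. Let $N\subseteq M$ be two finitely generated $A$-modules. Let $I$ be a regular ideal of $A$ having a principal reduction generated by a $d$-sequence with respect to $M/N$. Then, for every integer $n\ge d$, $$I^{n}M\cap N=I^{n-d}(I^{d}M\cap N).$$
   Context: All rings are commutative with identity. An ideal is regular if it contains a non zero divisor of $A$. An ideal $J\subseteq I$ is a reduction of $I$ if $I^{n+1}=JI^{n}$ for some integer $n\ge 0$; it is a principal reduction if moreover $J$ is principal. A sequence $x_1,\dots,x_s$ of elements of $A$ is a $d$-sequence with respect to an $A$-module $L$ if no $x_j$ lies in the ideal generated by the other $x_i$, and, with $J_0=0$ and $J_i=(x_1,\dots,x_i)$, one has $(J_iL:_L x_{i+1}x_k)=(J_iL:_L x_k)$ for all $i\ge 0$ and all $k\ge i+1$. For a single element $x$ (the case used here, with the principal reduction equal to $(x)$ and $L=M/N$) this means $x\neq 0$ and $(0:_L x^2)=(0:_L x)$. (The word "$d$-sequence" is unrelated to the integer $d$.) Integral degree: if $A\subseteq B$ is a ring extension and $b\in B$ is integral over $A$, then $\mathrm{id}_A(b)$ is the least $n\ge1$ such that $b$ satisfies a monic polynomial equation of degree $n$ with coefficients in $A$. If $A\subseteq B$ is an integral extension, $\mathrm{d}_A(B)=\sup\{\mathrm{id}_A(b)\mid b\in B\}$. $\overline{A}$ denotes the integral closure of $A$ in its total quotient ring, and $\mathrm{d}_A(\overline{A})$ is called the integral degree of $A$. *)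

theory Defs
  imports "HOL-Algebra.Algebra" "HOL-Library.Extended_Nat"
begin

section \<open>The total quotient ring\<close>

definition regular_elements :: "('a, 'm) ring_scheme \<Rightarrow> 'a set" where
  "regular_elements R = {s \<in> carrier R. \<forall>b \<in> carrier R. s \<otimes>\<^bsub>R\<^esub> b = \<zero>\<^bsub>R\<^esub> \<longrightarrow> b = \<zero>\<^bsub>R\<^esub>}"

definition regular_ideal :: "('a, 'm) ring_scheme \<Rightarrow> 'a set \<Rightarrow> bool" where
  "regular_ideal R I \<longleftrightarrow> ideal I R \<and> I \<inter> regular_elements R \<noteq> {}"

text \<open>Since the denominators are non zero divisors, no extra factor is needed in the
  equivalence of fractions.\<close>

definition frac_rel :: "('a, 'm) ring_scheme \<Rightarrow> (('a \<times> 'a) \<times> ('a \<times> 'a)) set" where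
  "frac_rel R = {((a, s), (b, t)). a \<in> carrier R \<and> s \<in> regular_elements R \<and>
     b \<in> carrier R \<and> t \<in> regular_elements R \<and> a \<otimes>\<^bsub>R\<^esub> t = b \<otimes>\<^bsub>R\<^esub> s}"

definition frac :: "('a, 'm) ring_scheme \<Rightarrow> 'a \<Rightarrow> 'a \<Rightarrow> ('a \<times> 'a) set" where
  "frac R a s = frac_rel R `` {(a, s)}"

text \<open>The unions below range over all representatives; they are single classes because the
  fraction does not depend on the representatives (see \<open>frac_add\<close> and \<open>frac_mult\<close>).\<close>

definition total_quotient_ring :: "('a, 'm) ring_scheme \<Rightarrow> ('a \<times> 'a) set ring" where
  "total_quotient_ring R =
    \<lparr>carrier = (carrier R \<times> regular_elements R) // frac_rel R,
     monoid.mult = (\<lambda>P Q. \<Union>p\<in>P. \<Union>q\<in>Q.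
              frac R (fst p \<otimes>\<^bsub>R\<^esub> fst q) (snd p \<otimes>\<^bsub>R\<^esub> snd q)),
     one = frac R \<one>\<^bsub>R\<^esub> \<one>\<^bsub>R\<^esub>,
     ring.zero = frac R \<zero>\<^bsub>R\<^esub> \<one>\<^bsub>R\<^esub>,
     add = (\<lambda>P Q. \<Union>p\<in>P. \<Union>q\<in>Q.
              frac R (fst p \<otimes>\<^bsub>R\<^esub> snd q \<oplus>\<^bsub>R\<^esub> fst q \<otimes>\<^bsub>R\<^esub> snd p) (snd p \<otimes>\<^bsub>R\<^esub> snd q))\<rparr>"

definition base_image :: "('a, 'm) ring_scheme \<Rightarrow> ('a \<times> 'a) set set" where
  "base_image R = (\<lambda>a. frac R a \<one>\<^bsub>R\<^esub>) ` carrier R"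

lemma regular_elements_carrier: "s \<in> regular_elements R \<Longrightarrow> s \<in> carrier R"
  unfolding regular_elements_def by blast

lemma (in cring) regular_elements_closed:
  assumes "s \<in> regular_elements R" "t \<in> regular_elements R"
  shows "s \<otimes> t \<in> regular_elements R"
proof -
  have c: "s \<in> carrier R" "t \<in> carrier R" using assms by (auto intro: regular_elements_carrier)
  have "b = \<zero>" if b: "b \<in> carrier R" and eq: "s \<otimes> t \<otimes> b = \<zero>" for b
  proof -
    have "s \<otimes> (t \<otimes> b) = \<zero>" using eq m_assoc[OF c b] by metis
    then have "t \<otimes> b = \<zero>" using assms(1) b c by (simp add: regular_elements_def)
    then show ?thesis using assms(2) b by (simp add: regular_elements_def)
  qed
  then show ?thesis using c by (simp add: regular_elements_def)
qed

lemma (in cring) one_regular: "\<one> \<in> regular_elements R"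
  by (auto simp: regular_elements_def)

lemma (in cring) regular_cancel:
  assumes "s \<in> regular_elements R" "a \<in> carrier R" "b \<in> carrier R" "a \<otimes> s = b \<otimes> s"
  shows "a = b"
proof -
  have s: "s \<in> carrier R" using assms(1) by (simp add: regular_elements_def)
  have "s \<otimes> (a \<ominus> b) = (a \<otimes> s) \<ominus> (b \<otimes> s)"
    using assms(2,3) s by (simp add: minus_eq r_distr r_minus m_comm[of s])
  also have "\<dots> = \<zero>" using assms(2-4) s by (metis m_closed r_right_minus_eq)
  finally have "a \<ominus> b = \<zero>"
    using assms(1-3) by (simp add: regular_elements_def)
  then show ?thesis using assms(2,3) by (metis r_right_minus_eq)
qed

lemma (in cring) frac_rel_equiv: "equiv (carrier R \<times> regular_elements R) (frac_rel R)"
proof (rule equivI)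
  show "frac_rel R \<subseteq> (carrier R \<times> regular_elements R) \<times> (carrier R \<times> regular_elements R)"
    by (auto simp: frac_rel_def)
  show "refl_on (carrier R \<times> regular_elements R) (frac_rel R)"
    by (auto simp: refl_on_def frac_rel_def)
  show "sym (frac_rel R)"
    by (auto simp: sym_def frac_rel_def)
  show "trans (frac_rel R)"
  proof (rule transI)
    fix x y z assume xy: "(x, y) \<in> frac_rel R" and yz: "(y, z) \<in> frac_rel R"
    obtain a s b t c u where e: "x = (a, s)" "y = (b, t)" "z = (c, u)"
      by (metis prod.exhaust)
    have m: "a \<in> carrier R" "b \<in> carrier R" "c \<in> carrier R" "s \<in> regular_elements R"
        "t \<in> regular_elements R" "u \<in> regular_elements R"
        "a \<otimes> t = b \<otimes> s" "b \<otimes> u = c \<otimes> t"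
      using xy yz e by (auto simp: frac_rel_def)
    have r: "s \<in> carrier R" "t \<in> carrier R" "u \<in> carrier R"
      using m(4-6) by (auto intro: regular_elements_carrier)
    have "(a \<otimes> u) \<otimes> t = (a \<otimes> t) \<otimes> u" using m(1-3) r by (simp add: m_ac)
    also have "\<dots> = (b \<otimes> s) \<otimes> u" by (simp only: m(7))
    also have "\<dots> = (b \<otimes> u) \<otimes> s" using m(1-3) r by (simp add: m_ac)
    also have "\<dots> = (c \<otimes> t) \<otimes> s" by (simp only: m(8))
    also have "\<dots> = (c \<otimes> s) \<otimes> t" using m(1-3) r by (simp add: m_ac)
    finally have "(a \<otimes> u) \<otimes> t = (c \<otimes> s) \<otimes> t" .
    then have "a \<otimes> u = c \<otimes> s" using regular_cancel[OF m(5)] m(1-3) r by simp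
    then show "(x, z) \<in> frac_rel R" using m(1,3,4,6) e by (simp add: frac_rel_def)
  qed
qed

lemma (in cring) frac_eq_iff:
  assumes "a \<in> carrier R" "s \<in> regular_elements R" "b \<in> carrier R" "t \<in> regular_elements R"
  shows "frac R a s = frac R b t \<longleftrightarrow> a \<otimes> t = b \<otimes> s"
  unfolding frac_def
  using eq_equiv_class_iff[OF frac_rel_equiv, of "(a, s)" "(b, t)"] assms
  by (simp add: frac_rel_def)

lemma (in cring) frac_mult:
  assumes "a \<in> carrier R" "s \<in> regular_elements R" "b \<in> carrier R" "t \<in> regular_elements R"
  shows "frac R a s \<otimes>\<^bsub>total_quotient_ring R\<^esub> frac R b t = frac R (a \<otimes> b) (s \<otimes> t)"
proof -
  have "frac R (fst p \<otimes> fst q) (snd p \<otimes> snd q) = frac R (a \<otimes> b) (s \<otimes> t)"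
    if pq: "p \<in> frac R a s" "q \<in> frac R b t" for p q
  proof -
    obtain a' s' b' t' where e: "p = (a', s')" "q = (b', t')" by (metis prod.exhaust)
    have m: "a' \<in> carrier R" "s' \<in> regular_elements R" "b' \<in> carrier R" "t' \<in> regular_elements R"
        "a \<otimes> s' = a' \<otimes> s" "b \<otimes> t' = b' \<otimes> t"
      using pq e by (auto simp: frac_def frac_rel_def)
    have r: "s \<in> carrier R" "t \<in> carrier R" "s' \<in> carrier R" "t' \<in> carrier R"
      using m(2,4) assms(2,4) by (auto intro: regular_elements_carrier)
    have "(a' \<otimes> b') \<otimes> (s \<otimes> t) = (a' \<otimes> s) \<otimes> (b' \<otimes> t)" using m(1,3) assms(1,3) r by (simp add: m_ac)
    also have "\<dots> = (a \<otimes> s') \<otimes> (b \<otimes> t')" by (simp only: m(5,6))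
    also have "\<dots> = (a \<otimes> b) \<otimes> (s' \<otimes> t')" using m(1,3) assms(1,3) r by (simp add: m_ac)
    finally show ?thesis using m(1-4) assms e by (simp add: frac_eq_iff regular_elements_closed)
  qed
  moreover have "(a, s) \<in> frac R a s" "(b, t) \<in> frac R b t"
    using assms by (auto simp: frac_def frac_rel_def)
  ultimately show ?thesis unfolding total_quotient_ring_def by simp blast
qed

lemma (in cring) frac_add:
  assumes "a \<in> carrier R" "s \<in> regular_elements R" "b \<in> carrier R" "t \<in> regular_elements R"
  shows "frac R a s \<oplus>\<^bsub>total_quotient_ring R\<^esub> frac R b t = frac R (a \<otimes> t \<oplus> b \<otimes> s) (s \<otimes> t)"
proof -
  have "frac R (fst p \<otimes> snd q \<oplus> fst q \<otimes> snd p) (snd p \<otimes> snd q)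
      = frac R (a \<otimes> t \<oplus> b \<otimes> s) (s \<otimes> t)"
    if pq: "p \<in> frac R a s" "q \<in> frac R b t" for p q
  proof -
    obtain a' s' b' t' where e: "p = (a', s')" "q = (b', t')" by (metis prod.exhaust)
    have m: "a' \<in> carrier R" "s' \<in> regular_elements R" "b' \<in> carrier R" "t' \<in> regular_elements R"
        "a \<otimes> s' = a' \<otimes> s" "b \<otimes> t' = b' \<otimes> t"
      using pq e by (auto simp: frac_def frac_rel_def)
    have r: "s \<in> carrier R" "t \<in> carrier R" "s' \<in> carrier R" "t' \<in> carrier R"
      using m(2,4) assms(2,4) by (auto intro: regular_elements_carrier)
    have "(a' \<otimes> t' \<oplus> b' \<otimes> s') \<otimes> (s \<otimes> t)
        = (a' \<otimes> s) \<otimes> (t \<otimes> t') \<oplus> (b' \<otimes> t) \<otimes> (s \<otimes> s')"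
      using m(1,3) assms(1,3) r by (simp add: m_ac l_distr r_distr)
    also have "\<dots> = (a \<otimes> s') \<otimes> (t \<otimes> t') \<oplus> (b \<otimes> t') \<otimes> (s \<otimes> s')" by (simp only: m(5,6))
    also have "\<dots> = (a \<otimes> t \<oplus> b \<otimes> s) \<otimes> (s' \<otimes> t')"
      using m(1,3) assms(1,3) r by (simp add: m_ac l_distr r_distr)
    finally show ?thesis using m(1-4) assms e r by (simp add: frac_eq_iff regular_elements_closed)
  qed
  moreover have "(a, s) \<in> frac R a s" "(b, t) \<in> frac R b t"
    using assms by (auto simp: frac_def frac_rel_def)
  ultimately show ?thesis unfolding total_quotient_ring_def by simp blast
qed

lemma total_quotient_ring_carrier:
  "carrier (total_quotient_ring R) = {frac R a s | a s. a \<in> carrier R \<and> s \<in> regular_elements R}"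
  by (auto simp: total_quotient_ring_def quotient_def frac_def)

lemma frac_closed:
  "a \<in> carrier R \<Longrightarrow> s \<in> regular_elements R \<Longrightarrow> frac R a s \<in> carrier (total_quotient_ring R)"
  unfolding total_quotient_ring_carrier by blast

lemma total_quotient_ring_one: "\<one>\<^bsub>total_quotient_ring R\<^esub> = frac R \<one>\<^bsub>R\<^esub> \<one>\<^bsub>R\<^esub>"
  and total_quotient_ring_zero: "\<zero>\<^bsub>total_quotient_ring R\<^esub> = frac R \<zero>\<^bsub>R\<^esub> \<one>\<^bsub>R\<^esub>"
  by (simp_all add: total_quotient_ring_def)

lemma (in cring) total_quotient_ring_cring: "cring (total_quotient_ring R)"
proof -
  let ?Q = "total_quotient_ring R"
  note C = total_quotient_ring_carrier
  note [simp] = frac_mult frac_add regular_elements_closed one_regular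
    total_quotient_ring_one total_quotient_ring_zero
  note reg = regular_elements_carrier
  show ?thesis
  proof (rule cringI)
    show "abelian_group ?Q"
    proof (rule abelian_groupI)
      fix x y assume x: "x \<in> carrier ?Q" and y: "y \<in> carrier ?Q"
      obtain a s where x: "x = frac R a s" "a \<in> carrier R" "s \<in> regular_elements R" using x unfolding C by blast
      obtain b t where y: "y = frac R b t" "b \<in> carrier R" "t \<in> regular_elements R" using y unfolding C by blast
      note r = reg[OF x(3)] reg[OF y(3)]
      have "a \<otimes> t \<oplus> b \<otimes> s \<in> carrier R" using x y r by simp
      then show "x \<oplus>\<^bsub>?Q\<^esub> y \<in> carrier ?Q" using x(3) y(3) by (simp add: x y frac_closed)
      show "x \<oplus>\<^bsub>?Q\<^esub> y = y \<oplus>\<^bsub>?Q\<^esub> x" using x(2,3) y(2,3) r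
        by (simp add: x(1) y(1) a_comm m_comm[of s t])
    next
      fix x y z assume x: "x \<in> carrier ?Q" and y: "y \<in> carrier ?Q" and z: "z \<in> carrier ?Q"
      obtain a s where x: "x = frac R a s" "a \<in> carrier R" "s \<in> regular_elements R" using x unfolding C by blast
      obtain b t where y: "y = frac R b t" "b \<in> carrier R" "t \<in> regular_elements R" using y unfolding C by blast
      obtain c u where z: "z = frac R c u" "c \<in> carrier R" "u \<in> regular_elements R" using z unfolding C by blast
      note r = reg[OF x(3)] reg[OF y(3)] reg[OF z(3)]
      show "(x \<oplus>\<^bsub>?Q\<^esub> y) \<oplus>\<^bsub>?Q\<^esub> z = x \<oplus>\<^bsub>?Q\<^esub> (y \<oplus>\<^bsub>?Q\<^esub> z)"
        using x(2,3) y(2,3) z(2,3) r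
        by (simp add: x(1) y(1) z(1) l_distr r_distr a_ac m_ac)
    next
      show "\<zero>\<^bsub>?Q\<^esub> \<in> carrier ?Q"
        by (simp add: frac_closed)
    next
      fix x assume x: "x \<in> carrier ?Q"
      obtain a s where x: "x = frac R a s" "a \<in> carrier R" "s \<in> regular_elements R" using x unfolding C by blast
      note r = reg[OF x(3)]
      show "\<zero>\<^bsub>?Q\<^esub> \<oplus>\<^bsub>?Q\<^esub> x = x" using x(2,3) r by (simp add: x(1))
      have "frac R (\<ominus> a) s \<in> carrier ?Q" using x(2,3) by (simp add: frac_closed)
      moreover have "frac R (\<ominus> a) s \<oplus>\<^bsub>?Q\<^esub> x = \<zero>\<^bsub>?Q\<^esub>"
        using x(2,3) r by (simp add: x(1) frac_eq_iff l_minus l_neg)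
      ultimately show "\<exists>y\<in>carrier ?Q. y \<oplus>\<^bsub>?Q\<^esub> x = \<zero>\<^bsub>?Q\<^esub>" by blast
    qed
  next
    show "comm_monoid ?Q"
    proof (rule comm_monoidI)
      fix x y assume x: "x \<in> carrier ?Q" and y: "y \<in> carrier ?Q"
      obtain a s where x: "x = frac R a s" "a \<in> carrier R" "s \<in> regular_elements R" using x unfolding C by blast
      obtain b t where y: "y = frac R b t" "b \<in> carrier R" "t \<in> regular_elements R" using y unfolding C by blast
      note r = reg[OF x(3)] reg[OF y(3)]
      show "x \<otimes>\<^bsub>?Q\<^esub> y \<in> carrier ?Q" using x(2,3) y(2,3) by (simp add: x(1) y(1) frac_closed)
      show "x \<otimes>\<^bsub>?Q\<^esub> y = y \<otimes>\<^bsub>?Q\<^esub> x" using x(2,3) y(2,3) r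
        by (simp add: x(1) y(1) m_comm[of s t] m_comm[of a b])
    next
      fix x y z assume x: "x \<in> carrier ?Q" and y: "y \<in> carrier ?Q" and z: "z \<in> carrier ?Q"
      obtain a s where x: "x = frac R a s" "a \<in> carrier R" "s \<in> regular_elements R" using x unfolding C by blast
      obtain b t where y: "y = frac R b t" "b \<in> carrier R" "t \<in> regular_elements R" using y unfolding C by blast
      obtain c u where z: "z = frac R c u" "c \<in> carrier R" "u \<in> regular_elements R" using z unfolding C by blast
      note r = reg[OF x(3)] reg[OF y(3)] reg[OF z(3)]
      show "(x \<otimes>\<^bsub>?Q\<^esub> y) \<otimes>\<^bsub>?Q\<^esub> z = x \<otimes>\<^bsub>?Q\<^esub> (y \<otimes>\<^bsub>?Q\<^esub> z)"
        using x(2,3) y(2,3) z(2,3) r by (simp add: x(1) y(1) z(1) m_assoc)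
    next
      show "\<one>\<^bsub>?Q\<^esub> \<in> carrier ?Q"
        by (simp add: frac_closed)
    next
      fix x assume x: "x \<in> carrier ?Q"
      obtain a s where x: "x = frac R a s" "a \<in> carrier R" "s \<in> regular_elements R" using x unfolding C by blast
      show "\<one>\<^bsub>?Q\<^esub> \<otimes>\<^bsub>?Q\<^esub> x = x" using x(2,3) reg[OF x(3)] by (simp add: x(1))
    qed
  next
    fix x y z assume x: "x \<in> carrier ?Q" and y: "y \<in> carrier ?Q" and z: "z \<in> carrier ?Q"
    obtain a s where x: "x = frac R a s" "a \<in> carrier R" "s \<in> regular_elements R" using x unfolding C by blast
    obtain b t where y: "y = frac R b t" "b \<in> carrier R" "t \<in> regular_elements R" using y unfolding C by blast
    obtain c u where z: "z = frac R c u" "c \<in> carrier R" "u \<in> regular_elements R" using z unfolding C by blast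
    note r = reg[OF x(3)] reg[OF y(3)] reg[OF z(3)]
    show "(x \<oplus>\<^bsub>?Q\<^esub> y) \<otimes>\<^bsub>?Q\<^esub> z = x \<otimes>\<^bsub>?Q\<^esub> z \<oplus>\<^bsub>?Q\<^esub> y \<otimes>\<^bsub>?Q\<^esub> z"
      using x(2,3) y(2,3) z(2,3) r
      by (simp add: x(1) y(1) z(1) frac_eq_iff l_distr r_distr m_ac)
  qed
qed

lemma (in cring) frac_one_hom: "(\<lambda>a. frac R a \<one>) \<in> ring_hom R (total_quotient_ring R)"
  by (rule ring_hom_memI)
    (simp_all add: frac_mult frac_add frac_closed one_regular total_quotient_ring_one)

lemma (in cring) frac_one_inj: "inj_on (\<lambda>a. frac R a \<one>) (carrier R)"
  by (rule inj_onI) (simp add: frac_eq_iff one_regular)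

lemma (in cring) base_image_subring: "subring (base_image R) (total_quotient_ring R)"
proof -
  interpret Q: cring "total_quotient_ring R" by (rule total_quotient_ring_cring)
  interpret h: ring_hom_ring R "total_quotient_ring R" "\<lambda>a. frac R a \<one>"
    using frac_one_hom by unfold_locales
  show ?thesis unfolding base_image_def
    by (rule h.img_is_subring[OF carrier_is_subring])
qed

lemma (in cring) regular_becomes_unit:
  assumes "s \<in> regular_elements R"
  shows "frac R s \<one> \<otimes>\<^bsub>total_quotient_ring R\<^esub> frac R \<one> s = \<one>\<^bsub>total_quotient_ring R\<^esub>"
proof -
  have "s \<in> carrier R" using assms by (rule regular_elements_carrier)
  then show ?thesis using assms
    by (simp add: frac_mult one_regular total_quotient_ring_one frac_eq_iff)
qed


section \<open>Integral degree\<close>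

text \<open>Here \<open>K\<close> is a subring of \<open>B\<close>. Polynomials of \<open>HOL-Algebra\<close> are coefficient lists with
  the leading coefficient first.\<close>

definition monic_equation :: "('a, 'm) ring_scheme \<Rightarrow> 'a set \<Rightarrow> 'a \<Rightarrow> nat \<Rightarrow> bool" where
  "monic_equation B K b n \<longleftrightarrow>
    (\<exists>p \<in> carrier (K[X]\<^bsub>B\<^esub>). p \<noteq> [] \<and> lead_coeff p = \<one>\<^bsub>B\<^esub> \<and> degree p = n \<and>
       ring.eval B p b = \<zero>\<^bsub>B\<^esub>)"

definition integral_closure :: "('a, 'm) ring_scheme \<Rightarrow> 'a set \<Rightarrow> 'a set" where
  "integral_closure B K = {b \<in> carrier B. \<exists>n\<ge>1. monic_equation B K b n}"

definition element_integral_degree :: "('a, 'm) ring_scheme \<Rightarrow> 'a set \<Rightarrow> 'a \<Rightarrow> nat" where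
  "element_integral_degree B K b = (LEAST n. n \<ge> 1 \<and> monic_equation B K b n)"

text \<open>\<open>d\<^sub>K(C)\<close> for \<open>K \<subseteq> C \<subseteq> B\<close> with \<open>C\<close> integral over \<open>K\<close>; the supremum is taken in
  \<^typ>\<open>enat\<close>, so it may be infinite.\<close>

definition extension_integral_degree :: "('a, 'm) ring_scheme \<Rightarrow> 'a set \<Rightarrow> 'a set \<Rightarrow> enat" where
  "extension_integral_degree B K C = (SUP b\<in>C. enat (element_integral_degree B K b))"

definition integral_degree :: "('a, 'm) ring_scheme \<Rightarrow> enat" where
  "integral_degree R =
    extension_integral_degree (total_quotient_ring R) (base_image R)
      (integral_closure (total_quotient_ring R) (base_image R))"


section \<open>Rings containing the rationals\<close>

definition rat_ring :: "rat ring" where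
  "rat_ring = \<lparr>carrier = UNIV, monoid.mult = (*), one = 1, ring.zero = 0, add = (+)\<rparr>"

definition contains_rationals :: "('a, 'm) ring_scheme \<Rightarrow> bool" where
  "contains_rationals R \<longleftrightarrow> (\<exists>f \<in> ring_hom rat_ring R. inj f)"


section \<open>Modules\<close>

definition module_span :: "('a, 'm) ring_scheme \<Rightarrow> ('a, 'b, 'n) module_scheme \<Rightarrow> 'b set \<Rightarrow> 'b set" where
  "module_span R M S = \<Inter>{H. submodule H R M \<and> S \<subseteq> H}"

definition finitely_generated_module ::
    "('a, 'm) ring_scheme \<Rightarrow> ('a, 'b, 'n) module_scheme \<Rightarrow> bool" where
  "finitely_generated_module R M \<longleftrightarrow>
    (\<exists>S \<subseteq> carrier M. finite S \<and> module_span R M S = carrier M)"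

definition ideal_module_prod ::
    "('a, 'm) ring_scheme \<Rightarrow> ('a, 'b, 'n) module_scheme \<Rightarrow> 'a set \<Rightarrow> 'b set \<Rightarrow> 'b set" where
  "ideal_module_prod R M I H = module_span R M {a \<odot>\<^bsub>M\<^esub> h | a h. a \<in> I \<and> h \<in> H}"

text \<open>The multiplication and unit of a module record carry no meaning for modules; they are
  left unspecified. The scalar action is well defined on cosets (see \<open>quotient_smult\<close>).\<close>

definition quotient_module ::
    "('a, 'm) ring_scheme \<Rightarrow> ('a, 'b, 'n) module_scheme \<Rightarrow> 'b set \<Rightarrow> ('a, 'b set) module" where
  "quotient_module R M N =
    \<lparr>carrier = a_rcosets\<^bsub>M\<^esub> N, monoid.mult = undefined, one = undefined, ring.zero = N,
     add = set_add M, smult = (\<lambda>a C. \<Union>x\<in>C. N +>\<^bsub>M\<^esub> (a \<odot>\<^bsub>M\<^esub> x))\<rparr>"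

lemma quotient_module_carrier:
  "carrier (quotient_module R M N) = {N +>\<^bsub>M\<^esub> x | x. x \<in> carrier M}"
  unfolding quotient_module_def A_RCOSETS_def' by auto

lemma (in module) submodule_abelian_subgroup:
  assumes "submodule N R M"
  shows "abelian_subgroup N M"
  using abelian_subgroupI2[OF M.a_comm_group submodule.axioms(1)[OF assms]] .

lemma (in module) quotient_add:
  assumes "submodule N R M" "x \<in> carrier M" "y \<in> carrier M"
  shows "(N +>\<^bsub>M\<^esub> x) \<oplus>\<^bsub>quotient_module R M N\<^esub> (N +>\<^bsub>M\<^esub> y) = N +>\<^bsub>M\<^esub> (x \<oplus>\<^bsub>M\<^esub> y)"
  using abelian_subgroup.a_rcos_sum[OF submodule_abelian_subgroup[OF assms(1)] assms(2,3)]
  by (simp add: quotient_module_def)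

lemma (in module) quotient_smult:
  assumes N: "submodule N R M" and a: "a \<in> carrier R" and x: "x \<in> carrier M"
  shows "a \<odot>\<^bsub>quotient_module R M N\<^esub> (N +>\<^bsub>M\<^esub> x) = N +>\<^bsub>M\<^esub> (a \<odot>\<^bsub>M\<^esub> x)"
proof -
  interpret S: abelian_subgroup N M by (rule submodule_abelian_subgroup[OF N])
  have "N +>\<^bsub>M\<^esub> (a \<odot>\<^bsub>M\<^esub> y) = N +>\<^bsub>M\<^esub> (a \<odot>\<^bsub>M\<^esub> x)" if y: "y \<in> N +>\<^bsub>M\<^esub> x" for y
  proof -
    obtain h where h: "h \<in> N" "y = h \<oplus>\<^bsub>M\<^esub> x" using y unfolding a_r_coset_def' by auto
    have hM: "h \<in> carrier M" using h submoduleE(1)[OF N] by blast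
    have ah: "a \<odot>\<^bsub>M\<^esub> h \<in> N" using submoduleE(4)[OF N a h(1)] .
    have "a \<odot>\<^bsub>M\<^esub> y = a \<odot>\<^bsub>M\<^esub> h \<oplus>\<^bsub>M\<^esub> a \<odot>\<^bsub>M\<^esub> x" using a x hM h by (simp add: smult_r_distr)
    then have "a \<odot>\<^bsub>M\<^esub> y \<in> N +>\<^bsub>M\<^esub> (a \<odot>\<^bsub>M\<^esub> x)" unfolding a_r_coset_def' using ah by auto
    then show ?thesis using S.a_repr_independence'[of "a \<odot>\<^bsub>M\<^esub> y" "a \<odot>\<^bsub>M\<^esub> x"] a x by simp
  qed
  then have "(\<Union>y\<in>N +>\<^bsub>M\<^esub> x. N +>\<^bsub>M\<^esub> (a \<odot>\<^bsub>M\<^esub> y)) = (\<Union>y\<in>N +>\<^bsub>M\<^esub> x. N +>\<^bsub>M\<^esub> (a \<odot>\<^bsub>M\<^esub> x))"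
    by (intro SUP_cong refl)
  also have "\<dots> = N +>\<^bsub>M\<^esub> (a \<odot>\<^bsub>M\<^esub> x)" using S.a_rcos_self[OF x] by force
  finally show ?thesis by (simp add: quotient_module_def)
qed

lemma (in module) quotient_zero:
  assumes "submodule N R M"
  shows "\<zero>\<^bsub>quotient_module R M N\<^esub> = N +>\<^bsub>M\<^esub> \<zero>\<^bsub>M\<^esub>"
  using M.a_coset_add_zero[OF submoduleE(1)[OF assms]] by (simp add: quotient_module_def)

lemma (in module) quotient_module_module:
  assumes N: "submodule N R M"
  shows "module R (quotient_module R M N)"
proof -
  let ?L = "quotient_module R M N"
  note [simp] = quotient_add[OF N] quotient_smult[OF N] quotient_zero[OF N]
  have in_L: "N +>\<^bsub>M\<^esub> x \<in> carrier ?L" if "x \<in> carrier M" for x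
    using that unfolding quotient_module_carrier by blast
  have rep: "\<exists>x. x \<in> carrier M \<and> P = N +>\<^bsub>M\<^esub> x" if "P \<in> carrier ?L" for P
    using that unfolding quotient_module_carrier by blast
  show ?thesis
  proof (rule moduleI)
    show "cring R" ..
    show "abelian_group ?L"
    proof (rule abelian_groupI)
      fix P Q assume "P \<in> carrier ?L" "Q \<in> carrier ?L"
      then obtain x y where xy: "x \<in> carrier M" "y \<in> carrier M" "P = N +>\<^bsub>M\<^esub> x" "Q = N +>\<^bsub>M\<^esub> y"
        by (metis rep)
      show "P \<oplus>\<^bsub>?L\<^esub> Q \<in> carrier ?L" using xy(1,2) by (simp add: xy(3,4) in_L)
      show "P \<oplus>\<^bsub>?L\<^esub> Q = Q \<oplus>\<^bsub>?L\<^esub> P" using xy(1,2) by (simp add: xy(3,4) M.a_comm)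
    next
      fix P Q S assume "P \<in> carrier ?L" "Q \<in> carrier ?L" "S \<in> carrier ?L"
      then obtain x y z where xyz: "x \<in> carrier M" "y \<in> carrier M" "z \<in> carrier M"
          "P = N +>\<^bsub>M\<^esub> x" "Q = N +>\<^bsub>M\<^esub> y" "S = N +>\<^bsub>M\<^esub> z"
        by (metis rep)
      show "P \<oplus>\<^bsub>?L\<^esub> Q \<oplus>\<^bsub>?L\<^esub> S = P \<oplus>\<^bsub>?L\<^esub> (Q \<oplus>\<^bsub>?L\<^esub> S)"
        using xyz(1-3) by (simp add: xyz(4-6) M.a_assoc)
    next
      show "\<zero>\<^bsub>?L\<^esub> \<in> carrier ?L" by (simp add: in_L)
    next
      fix P assume "P \<in> carrier ?L"
      then obtain x where x: "x \<in> carrier M" "P = N +>\<^bsub>M\<^esub> x" by (metis rep)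
      show "\<zero>\<^bsub>?L\<^esub> \<oplus>\<^bsub>?L\<^esub> P = P" using x(1) by (simp add: x(2))
      have "(N +>\<^bsub>M\<^esub> (\<ominus>\<^bsub>M\<^esub> x)) \<oplus>\<^bsub>?L\<^esub> P = \<zero>\<^bsub>?L\<^esub>" using x(1) by (simp add: x(2) M.l_neg)
      then show "\<exists>Q\<in>carrier ?L. Q \<oplus>\<^bsub>?L\<^esub> P = \<zero>\<^bsub>?L\<^esub>"
        using in_L[OF M.a_inv_closed[OF x(1)]] by blast
    qed
  next
    fix a P assume a: "a \<in> carrier R" and "P \<in> carrier ?L"
    then obtain x where x: "x \<in> carrier M" "P = N +>\<^bsub>M\<^esub> x" by (metis rep)
    show "a \<odot>\<^bsub>?L\<^esub> P \<in> carrier ?L" using a x(1) by (simp add: x(2) in_L)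
  next
    fix a b P assume ab: "a \<in> carrier R" "b \<in> carrier R" and "P \<in> carrier ?L"
    then obtain x where x: "x \<in> carrier M" "P = N +>\<^bsub>M\<^esub> x" by (metis rep)
    show "(a \<oplus> b) \<odot>\<^bsub>?L\<^esub> P = a \<odot>\<^bsub>?L\<^esub> P \<oplus>\<^bsub>?L\<^esub> b \<odot>\<^bsub>?L\<^esub> P"
      using ab x(1) by (simp add: x(2) smult_l_distr)
    show "(a \<otimes> b) \<odot>\<^bsub>?L\<^esub> P = a \<odot>\<^bsub>?L\<^esub> (b \<odot>\<^bsub>?L\<^esub> P)"
      using ab x(1) by (simp add: x(2) smult_assoc1)
  next
    fix a P Q assume a: "a \<in> carrier R" and "P \<in> carrier ?L" "Q \<in> carrier ?L"
    then obtain x y where xy: "x \<in> carrier M" "y \<in> carrier M" "P = N +>\<^bsub>M\<^esub> x" "Q = N +>\<^bsub>M\<^esub> y"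
      by (metis rep)
    show "a \<odot>\<^bsub>?L\<^esub> (P \<oplus>\<^bsub>?L\<^esub> Q) = a \<odot>\<^bsub>?L\<^esub> P \<oplus>\<^bsub>?L\<^esub> a \<odot>\<^bsub>?L\<^esub> Q"
      using a xy(1,2) by (simp add: xy(3,4) smult_r_distr)
  next
    fix P assume "P \<in> carrier ?L"
    then obtain x where x: "x \<in> carrier M" "P = N +>\<^bsub>M\<^esub> x" by (metis rep)
    show "\<one> \<odot>\<^bsub>?L\<^esub> P = P" using x(1) by (simp add: x(2))
  qed
qed

text \<open>\<open>(H :\<^sub>L x)\<close>\<close>

definition module_colon :: "('a, 'b, 'n) module_scheme \<Rightarrow> 'b set \<Rightarrow> 'a \<Rightarrow> 'b set" where
  "module_colon L H x = {l \<in> carrier L. x \<odot>\<^bsub>L\<^esub> l \<in> H}"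


section \<open>Reductions and d-sequences\<close>

definition reduction :: "('a, 'm) ring_scheme \<Rightarrow> 'a set \<Rightarrow> 'a set \<Rightarrow> bool" where
  "reduction R J I \<longleftrightarrow> ideal J R \<and> ideal I R \<and> J \<subseteq> I \<and>
    (\<exists>n::nat. I [^]\<^bsub>ideals_set R\<^esub> Suc n = J \<cdot>\<^bsub>R\<^esub> (I [^]\<^bsub>ideals_set R\<^esub> n))"

definition principal_reduction :: "('a, 'm) ring_scheme \<Rightarrow> 'a set \<Rightarrow> 'a set \<Rightarrow> bool" where
  "principal_reduction R J I \<longleftrightarrow> reduction R J I \<and> principalideal J R"

text \<open>The list is indexed from \<open>0\<close>: \<open>xs ! i\<close> is the element \<open>x\<^sub>i\<^sub>+\<^sub>1\<close>, and
  \<open>Idl (set (take i xs))\<close> is \<open>J\<^sub>i = (x\<^sub>1, \<dots>, x\<^sub>i)\<close>.\<close>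

definition d_sequence ::
    "('a, 'm) ring_scheme \<Rightarrow> ('a, 'b, 'n) module_scheme \<Rightarrow> 'a list \<Rightarrow> bool" where
  "d_sequence R L xs \<longleftrightarrow>
    set xs \<subseteq> carrier R \<and>
    (\<forall>j < length xs. xs ! j \<notin> Idl\<^bsub>R\<^esub> {xs ! i | i. i < length xs \<and> i \<noteq> j}) \<and>
    (\<forall>i k. i \<le> k \<and> k < length xs \<longrightarrow>
      (let JL = ideal_module_prod R L (Idl\<^bsub>R\<^esub> (set (take i xs))) (carrier L)
       in module_colon L JL (xs ! i \<otimes>\<^bsub>R\<^esub> xs ! k) = module_colon L JL (xs ! k)))"

lemma (in module) d_sequence_single:
  "d_sequence R M [x] \<longleftrightarrow>
    x \<in> carrier R \<and> x \<noteq> \<zero> \<and>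
    module_colon M {\<zero>\<^bsub>M\<^esub>} (x \<otimes> x) = module_colon M {\<zero>\<^bsub>M\<^esub>} x"
proof -
  have e: "Idl {} = {\<zero>}"
  proof
    show "Idl {} \<subseteq> {\<zero>}" unfolding genideal_def using R.zeroideal by blast
    show "{\<zero>} \<subseteq> Idl {}" unfolding genideal_def
      using additive_subgroup.zero_closed ideal.axioms(1) by fastforce
  qed
  have z: "submodule {\<zero>\<^bsub>M\<^esub>} R M" by (rule submoduleI) auto
  have sub0: "\<zero>\<^bsub>M\<^esub> \<in> H" if "submodule H R M" for H
    using subgroup.one_closed[OF submodule.axioms(1)[OF that]] by simp
  have g: "{a \<odot>\<^bsub>M\<^esub> h |a h. a \<in> {\<zero>} \<and> h \<in> carrier M} \<subseteq> {\<zero>\<^bsub>M\<^esub>}"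
    by (clarsimp simp: smult_l_null)
  have "ideal_module_prod R M {\<zero>} (carrier M) = {\<zero>\<^bsub>M\<^esub>}"
    unfolding ideal_module_prod_def module_span_def
  proof (rule equalityI)
    show "\<Inter>{H. submodule H R M \<and> {a \<odot>\<^bsub>M\<^esub> h |a h. a \<in> {\<zero>} \<and> h \<in> carrier M} \<subseteq> H} \<subseteq> {\<zero>\<^bsub>M\<^esub>}"
      by (rule Inter_lower) (use z g in simp)
    show "{\<zero>\<^bsub>M\<^esub>} \<subseteq> \<Inter>{H. submodule H R M \<and> {a \<odot>\<^bsub>M\<^esub> h |a h. a \<in> {\<zero>} \<and> h \<in> carrier M} \<subseteq> H}"
      by (rule Inter_greatest) (simp add: sub0)
  qed
  then show ?thesis unfolding d_sequence_def by (simp add: e Let_def)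
qed

end

theory Submission
  imports Defs
begin

text \<open>Let \<open>(x)\<close> be the reduction. Then \<open>x\<close> is regular, and for \<open>a \<in> I\<close> the fraction \<open>a / x\<close> is
  integral over \<open>A\<close>: since \<open>I\<^bsup>r+k\<^esup> = x\<^sup>k I\<^sup>r\<close>, the elements \<open>x\<^sup>r (a / x)\<^sup>k\<close> lie in \<open>A\<close>, and the ideals
  generated by the first \<open>m\<close> of them become stationary. Hence \<open>a / x\<close> satisfies a monic equation
  of degree at most \<open>d\<close>, and clearing denominators gives \<open>a\<^sup>d \<in> x I\<^bsup>d-1\<^esup>\<close>. Over the rationals the
  \<open>d\<close>-th powers generate \<open>I\<^sup>d\<close>, so \<open>I\<^sup>d = x I\<^bsup>d-1\<^esup>\<close> and \<open>I\<^sup>n = x\<^bsup>n-d+1\<^esup> I\<^bsup>d-1\<^esup>\<close>. An element of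
  \<open>I\<^sup>n M \<inter> N\<close> is therefore \<open>x\<^bsup>n-d\<^esup> (x w)\<close> with \<open>w \<in> I\<^bsup>d-1\<^esup> M\<close>, and the d-sequence condition on
  \<open>M / N\<close> turns \<open>x\<^bsup>n-d+1\<^esup> w \<in> N\<close> into \<open>x w \<in> N\<close>.\<close>

section \<open>Powers of ideals\<close>

lemma ideals_set_sel [simp]:
  "monoid.mult (ideals_set R) = ideal_prod R" "one (ideals_set R) = carrier R"
  "carrier (ideals_set R) = {J. ideal J R}"
  by (simp_all add: ideals_set_def)

context cring
begin

abbreviation ideal_pow :: "'a set \<Rightarrow> nat \<Rightarrow> 'a set" where
  "ideal_pow I n \<equiv> I [^]\<^bsub>ideals_set R\<^esub> n"

lemma ideal_pow_0: "ideal_pow I 0 = carrier R"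
  and ideal_pow_Suc: "ideal_pow I (Suc n) = ideal_pow I n \<cdot> I"
  by (simp_all add: nat_pow_def)

lemma ideal_pow_ideal: "ideal I R \<Longrightarrow> ideal (ideal_pow I n) R"
  by (induction n) (simp_all add: ideal_pow_0 ideal_pow_Suc oneideal ideal_prod_is_ideal)

lemma ideal_pow_carrier: "ideal I R \<Longrightarrow> z \<in> ideal_pow I n \<Longrightarrow> z \<in> carrier R"
  using ideal.Icarr ideal_pow_ideal by metis

lemma ideal_pow_mult:
  assumes I: "ideal I R" and "u \<in> ideal_pow I m" "v \<in> ideal_pow I n"
  shows "u \<otimes> v \<in> ideal_pow I (m + n)"
proof -
  have "ideal_pow I m \<cdot> ideal_pow I n = ideal_pow I (m + n)"
    using comm_monoid.axioms(1)[OF ideals_set_is_comm_monoid] I monoid.nat_pow_mult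
    by fastforce
  then show ?thesis using assms(2,3) ideal_prod.prod by metis
qed

lemma ideal_pow_elem: "ideal I R \<Longrightarrow> a \<in> I \<Longrightarrow> a [^] n \<in> ideal_pow I n"
  by (induction n) (simp_all add: ideal_pow_0 ideal_pow_Suc ideal_prod.prod)

lemma ideal_pow_1: "ideal I R \<Longrightarrow> ideal_pow I (Suc 0) = I"
  unfolding ideal_pow_Suc ideal_pow_0
  using ideal_prod_commute[OF oneideal] ideal_prod_one by metis

section \<open>Multiples of an ideal by an element, and powers of an ideal with a principal
  reduction\<close>

lemma principal_mult_ideal:
  assumes x: "x \<in> carrier R" and K: "ideal K R"
  shows "ideal ((\<lambda>z. x \<otimes> z) ` K) R"
proof (rule idealI)
  interpret K: ideal K R by fact
  show "ring R" ..
  show "subgroup ((\<lambda>z. x \<otimes> z) ` K) (add_monoid R)"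
  proof (rule add.subgroupI)
    show "(\<lambda>z. x \<otimes> z) ` K \<subseteq> carrier R" using x by auto
    show "(\<lambda>z. x \<otimes> z) ` K \<noteq> {}" using K.zero_closed by blast
  next
    fix u assume "u \<in> (\<lambda>z. x \<otimes> z) ` K"
    then obtain z where "z \<in> K" "u = x \<otimes> z" by blast
    then show "\<ominus> u \<in> (\<lambda>z. x \<otimes> z) ` K" using x
      by (intro image_eqI[of _ _ "\<ominus> z"]) (auto simp: r_minus)
  next
    fix u v assume "u \<in> (\<lambda>z. x \<otimes> z) ` K" "v \<in> (\<lambda>z. x \<otimes> z) ` K"
    then obtain z w where "z \<in> K" "u = x \<otimes> z" "w \<in> K" "v = x \<otimes> w" by blast
    then show "u \<oplus> v \<in> (\<lambda>z. x \<otimes> z) ` K" using x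
      by (intro image_eqI[of _ _ "z \<oplus> w"]) (auto simp: r_distr)
  qed
next
  interpret K: ideal K R by fact
  fix u c assume "u \<in> (\<lambda>z. x \<otimes> z) ` K" and c: "c \<in> carrier R"
  then obtain z where z: "z \<in> K" "u = x \<otimes> z" by blast
  have zc: "z \<in> carrier R" using z by simp
  show "c \<otimes> u \<in> (\<lambda>z. x \<otimes> z) ` K"
    using x c z zc K.I_l_closed[of z c] by (intro image_eqI[of _ _ "c \<otimes> z"]) (auto simp: m_lcomm)
  show "u \<otimes> c \<in> (\<lambda>z. x \<otimes> z) ` K"
    using x c z zc K.I_r_closed[of z c] by (intro image_eqI[of _ _ "z \<otimes> c"]) (auto simp: m_assoc)
qed

text \<open>A generator \<open>i j\<close> with \<open>i = c x\<close> is \<open>x (c j)\<close>,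
  and sums stay inside because \<open>x K\<close> is an ideal. Every element of \<open>(x) K\<close>
  is thus a single multiple of \<open>x\<close>, which makes division by \<open>x\<close>
  possible.\<close>

lemma ideal_prod_principal:
  assumes x: "x \<in> carrier R" and K: "ideal K R"
  shows "(Idl {x}) \<cdot> K = (\<lambda>z. x \<otimes> z) ` K"
proof
  interpret K: ideal K R by fact
  interpret xK: ideal "(\<lambda>z. x \<otimes> z) ` K" R by (rule principal_mult_ideal[OF x K])
  show "(Idl {x}) \<cdot> K \<subseteq> (\<lambda>z. x \<otimes> z) ` K"
  proof
    fix u assume "u \<in> (Idl {x}) \<cdot> K"
    then show "u \<in> (\<lambda>z. x \<otimes> z) ` K"
    proof (induction u rule: ideal_prod.induct)
      case (prod i j)
      then obtain c where c: "c \<in> carrier R" "i = c \<otimes> x"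
        using cgenideal_eq_genideal[OF x] unfolding cgenideal_def by blast
      have "i \<otimes> j = x \<otimes> (c \<otimes> j)" using c x K.Icarr[OF prod(2)] by (simp add: m_ac)
      then show ?case using c prod(2) by (auto intro!: K.I_l_closed)
    qed (rule xK.a_closed)
  qed
  show "(\<lambda>z. x \<otimes> z) ` K \<subseteq> (Idl {x}) \<cdot> K"
    using genideal_self'[OF x] by (auto intro: ideal_prod.prod)
qed

text \<open>Each further factor \<open>i\<close> from \<open>I\<close> is absorbed:
  \<open>z i\<close> lies in \<open>I^(k+1)\<close>, hence equals \<open>x w\<close> with
  \<open>w\<close> in \<open>I^k\<close>. This serves twice, with the given reduction exponent to
  show that fractions are integral, and with \<open>d - 1\<close> in the final argument.\<close>

lemma ideal_pow_reduction:
  assumes I: "ideal I R" and x: "x \<in> carrier R"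
    and red: "ideal_pow I (Suc k) \<subseteq> (\<lambda>z. x \<otimes> z) ` ideal_pow I k"
  shows "ideal_pow I (k + j) \<subseteq> (\<lambda>z. x [^] j \<otimes> z) ` ideal_pow I k"
proof (induction j)
  case 0
  then show ?case using ideal_pow_carrier[OF I] by (auto intro!: image_eqI)
next
  case (Suc j)
  interpret L: ideal "(\<lambda>z. x [^] Suc j \<otimes> z) ` ideal_pow I k" R
    using x by (intro principal_mult_ideal ideal_pow_ideal I) simp
  show ?case
  proof
    fix u assume "u \<in> ideal_pow I (k + Suc j)"
    then have "u \<in> ideal_pow I (k + j) \<cdot> I" by (simp add: ideal_pow_Suc)
    then show "u \<in> (\<lambda>z. x [^] Suc j \<otimes> z) ` ideal_pow I k"
    proof (induction u rule: ideal_prod.induct)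
      case (prod u i)
      then obtain z where z: "z \<in> ideal_pow I k" "u = x [^] j \<otimes> z" using Suc by blast
      have "z \<otimes> i \<in> ideal_pow I (Suc k)" using z prod(2) by (simp add: ideal_pow_Suc ideal_prod.prod)
      then obtain w where w: "w \<in> ideal_pow I k" "z \<otimes> i = x \<otimes> w" using red by blast
      have c: "z \<in> carrier R" "w \<in> carrier R" "i \<in> carrier R"
        using z w prod(2) ideal_pow_carrier[OF I] ideal.Icarr[OF I] by auto
      have "u \<otimes> i = x [^] j \<otimes> (z \<otimes> i)" unfolding z(2) using c x by (intro m_assoc) auto
      also have "\<dots> = x [^] Suc j \<otimes> w" unfolding w(2) nat_pow_Suc using c x by (intro m_assoc[symmetric]) auto
      finally show ?case using w(1) by blast
    qed (rule L.a_closed)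
  qed
qed

section \<open>Powers over the rationals\<close>

text \<open>Comparing the values at \<open>u t\<close> and at \<open>t\<close> eliminates the top coefficient, so no Vandermonde
  determinant is needed.\<close>

lemma polynomial_coeffs_in_ideal:
  assumes K: "ideal K R" and u: "u \<in> carrier R"
    and reg: "\<And>(i::nat) j c. i < j \<Longrightarrow> c \<in> carrier R \<Longrightarrow> (u [^] i \<ominus> u [^] j) \<otimes> c \<in> K \<Longrightarrow> c \<in> K"
    and c: "c \<in> {..m::nat} \<rightarrow> carrier R"
    and val: "\<And>t. t \<in> carrier R \<Longrightarrow> (\<Oplus>j\<in>{..m}. t [^] j \<otimes> c j) \<in> K"
    and j: "j \<le> m"
  shows "c j \<in> K"
proof -
  interpret K: ideal K R by fact
  show ?thesis using c val j
  proof (induction m arbitrary: c j)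
    case 0
    then show ?case using 0(2)[of \<one>] by simp
  next
    case (Suc m)
    have cc: "\<And>j. j \<le> Suc m \<Longrightarrow> c j \<in> carrier R" using Suc.prems(1) by auto
    \<comment> \<open>With \<open>f(t)\<close> the sum of the \<open>t^j c j\<close>, these are the
      coefficients of \<open>f(u t) - u^(m+1) f(t)\<close>. The one at \<open>Suc m\<close>
      vanishes; from the others \<open>reg\<close> recovers \<open>c j\<close>.\<close>
    define e where "e j = (u [^] j \<ominus> u [^] Suc m) \<otimes> c j" for j
    have ec: "\<And>j. j \<le> Suc m \<Longrightarrow> e j \<in> carrier R" using cc u by (simp add: e_def)
    have e: "(\<Oplus>j\<in>{..m}. t [^] j \<otimes> e j) \<in> K" if t: "t \<in> carrier R" for t
    proof -
      let ?S = "\<lambda>t. \<Oplus>j\<in>{..Suc m}. t [^] j \<otimes> c j"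
      have "?S (u \<otimes> t) \<in> K" "u [^] Suc m \<otimes> ?S t \<in> K"
        using Suc.prems(2)[of "u \<otimes> t"] Suc.prems(2)[of t] t u K.I_l_closed by auto
      then have "?S (u \<otimes> t) \<oplus> \<ominus> (u [^] Suc m) \<otimes> ?S t \<in> K"
        using t u cc by (metis (no_types, lifting) K.Icarr K.a_closed K.a_inv_closed Suc.prems(2) l_minus nat_pow_closed)
      also have "\<ominus> (u [^] Suc m) \<otimes> ?S t = (\<Oplus>j\<in>{..Suc m}. \<ominus> (u [^] Suc m) \<otimes> (t [^] j \<otimes> c j))"
        using t u cc by (intro finsum_rdistr) auto
      also have "?S (u \<otimes> t) \<oplus> \<dots> =
          (\<Oplus>j\<in>{..Suc m}. (u \<otimes> t) [^] j \<otimes> c j \<oplus> \<ominus> (u [^] Suc m) \<otimes> (t [^] j \<otimes> c j))"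
        using t u cc by (intro add.finprod_multf[symmetric]) auto
      also have "\<dots> = (\<Oplus>j\<in>{..Suc m}. t [^] j \<otimes> e j)"
      proof (intro add.finprod_cong')
        fix j assume "j \<in> {..Suc m}"
        then show "(u \<otimes> t) [^] j \<otimes> c j \<oplus> \<ominus> (u [^] Suc m) \<otimes> (t [^] j \<otimes> c j) = t [^] j \<otimes> e j"
          using t u cc[of j]
          by (simp add: e_def nat_pow_distrib l_distr r_distr minus_eq l_minus r_minus m_ac del: nat_pow_Suc)
      qed (use t ec in auto)
      also have "\<dots> = t [^] Suc m \<otimes> e (Suc m) \<oplus> (\<Oplus>j\<in>{..m}. t [^] j \<otimes> e j)"
        using t ec by (intro finsum_Suc) auto
      also have "e (Suc m) = \<zero>" using u cc by (simp add: e_def r_neg minus_eq)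
      also have "t [^] Suc m \<otimes> \<zero> \<oplus> (\<Oplus>j\<in>{..m}. t [^] j \<otimes> e j) = (\<Oplus>j\<in>{..m}. t [^] j \<otimes> e j)"
        using t ec by (simp add: Pi_def)
      finally show ?thesis .
    qed
    have low: "c j \<in> K" if j: "j \<le> m" for j
    proof (rule reg)
      show "(u [^] j \<ominus> u [^] Suc m) \<otimes> c j \<in> K"
        using Suc.IH[of e j] ec e j by (auto simp: e_def)
    qed (use j cc in auto)
    show ?case
    proof (cases "j \<le> m")
      case False
      then have j: "j = Suc m" using Suc.prems(3) by simp
      have "(\<Oplus>j\<in>{..m}. c j) \<in> K" if "\<And>j. j \<le> m \<Longrightarrow> c j \<in> K" for m
        using that by (induction m) (auto simp: Pi_def K.Icarr intro!: K.a_closed)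
      then have lK: "(\<Oplus>j\<in>{..m}. c j) \<in> K" using low by blast
      \<comment> \<open>The value at \<open>\<one>\<close> is the sum of all coefficients;
        subtracting the lower ones, already in \<open>K\<close>, leaves the top one.\<close>
      have "(\<Oplus>j\<in>{..Suc m}. \<one> [^] j \<otimes> c j) = (\<Oplus>j\<in>{..Suc m}. c j)"
        using cc by (intro add.finprod_cong') auto
      also have "\<dots> = c (Suc m) \<oplus> (\<Oplus>j\<in>{..m}. c j)"
        using cc by (intro finsum_Suc) auto
      finally have "c (Suc m) \<oplus> (\<Oplus>j\<in>{..m}. c j) \<in> K"
        using Suc.prems(2)[of \<one>] by simp
      then have "c (Suc m) \<oplus> (\<Oplus>j\<in>{..m}. c j) \<oplus> \<ominus> (\<Oplus>j\<in>{..m}. c j) \<in> K"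
        using lK by blast
      then show ?thesis using cc[of "Suc m"] K.Icarr[OF lK] j by (simp add: a_assoc r_neg)
    qed (rule low)
  qed
qed

text \<open>The linear coefficient is the derivative of the \<open>n\<close>-th power at
  \<open>y\<close> in direction \<open>b\<close>. The coefficients are chosen before
  \<open>t\<close>, so that one coefficient family serves all values of \<open>t\<close>.\<close>

lemma binomial_linear_term:
  fixes n :: nat
  assumes y: "y \<in> carrier R" and b: "b \<in> carrier R"
  shows "\<exists>c \<in> UNIV \<rightarrow> carrier R. c 1 = [n] \<cdot> (b \<otimes> y [^] (n - 1)) \<and>
    (\<forall>t \<in> carrier R. (y \<oplus> t \<otimes> b) [^] n = (\<Oplus>j\<in>{..n}. t [^] j \<otimes> c j))"
proof -
  \<comment> \<open>Strengthened for the induction: \<open>c 0\<close> contributes to the next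
    linear coefficient, and the vanishing beyond \<open>n\<close> allows the sum to be extended by
    one term.\<close>
  have "\<exists>c \<in> UNIV \<rightarrow> carrier R. c 0 = y [^] n \<and> c 1 = [n] \<cdot> (b \<otimes> y [^] (n - 1)) \<and> (\<forall>j>n. c j = \<zero>) \<and>
    (\<forall>t \<in> carrier R. (y \<oplus> t \<otimes> b) [^] n = (\<Oplus>j\<in>{..n}. t [^] j \<otimes> c j))"
  proof (induction n)
    case 0
    show ?case by (rule bexI[of _ "\<lambda>j. if j = 0 then \<one> else \<zero>"]) auto
  next
    case (Suc n)
    then obtain c where c: "c \<in> UNIV \<rightarrow> carrier R" "c 0 = y [^] n" "c 1 = [n] \<cdot> (b \<otimes> y [^] (n - 1))"
      "\<And>j. j > n \<Longrightarrow> c j = \<zero>"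
      "\<And>t. t \<in> carrier R \<Longrightarrow> (y \<oplus> t \<otimes> b) [^] n = (\<Oplus>j\<in>{..n}. t [^] j \<otimes> c j)"
      by blast
    have cc [simp]: "c j \<in> carrier R" for j using c(1) by auto
    \<comment> \<open>The shift by one index is multiplication by \<open>t\<close>, so
      \<open>c j y + s j b\<close> are the coefficients after multiplying by
      \<open>y + t b\<close>.\<close>
    define s where "s j = (case j of 0 \<Rightarrow> \<zero> | Suc i \<Rightarrow> c i)" for j
    have sc [simp]: "s j \<in> carrier R" for j by (simp add: s_def split: nat.split)
    let ?c = "\<lambda>j. c j \<otimes> y \<oplus> s j \<otimes> b"
    have one: "?c 1 = [Suc n] \<cdot> (b \<otimes> y [^] (Suc n - 1))"
    proof (cases n)
      case 0
      then show ?thesis using c y b by (simp add: s_def)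
    next
      case (Suc m)
      then have "?c 1 = [n] \<cdot> (b \<otimes> y [^] m) \<otimes> y \<oplus> y [^] n \<otimes> b"
        using c by (simp add: s_def)
      also have "[n] \<cdot> (b \<otimes> y [^] m) \<otimes> y = [n] \<cdot> (b \<otimes> y [^] n)"
      proof -
        have "y [^] n = y [^] m \<otimes> y" using Suc by simp
        then show ?thesis using y b by (simp add: add_pow_ldistr m_assoc)
      qed
      finally show ?thesis using y b by (simp add: m_comm)
    qed
    have "(y \<oplus> t \<otimes> b) [^] Suc n = (\<Oplus>j\<in>{..Suc n}. t [^] j \<otimes> ?c j)" if t: "t \<in> carrier R" for t
    proof -
      let ?S = "\<Oplus>j\<in>{..n}. t [^] j \<otimes> c j"
      have S: "?S \<in> carrier R" using t by (intro finsum_closed) auto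
      have 1: "(\<Oplus>j\<in>{..Suc n}. t [^] j \<otimes> c j) = ?S"
        using t c(4)[of "Suc n"] S by (subst finsum_Suc) auto
      have "(\<Oplus>j\<in>{..Suc n}. t [^] j \<otimes> s j) = (\<Oplus>j\<in>{..n}. t [^] Suc j \<otimes> s (Suc j)) \<oplus> t [^] (0::nat) \<otimes> s 0"
        using t by (intro finsum_Suc2) auto
      also have "\<dots> = (\<Oplus>j\<in>{..n}. t \<otimes> (t [^] j \<otimes> c j))"
      proof -
        have "(\<Oplus>j\<in>{..n}. t [^] Suc j \<otimes> s (Suc j)) = (\<Oplus>j\<in>{..n}. t \<otimes> (t [^] j \<otimes> c j))"
          using t by (intro add.finprod_cong') (auto simp: s_def m_ac)
        moreover have "(\<Oplus>j\<in>{..n}. t \<otimes> (t [^] j \<otimes> c j)) \<in> carrier R" using t by auto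
        ultimately show ?thesis by (simp add: s_def)
      qed
      also have "\<dots> = t \<otimes> ?S" using t by (intro finsum_rdistr[symmetric]) auto
      finally have 2: "(\<Oplus>j\<in>{..Suc n}. t [^] j \<otimes> s j) = t \<otimes> ?S" .
      have "(\<Oplus>j\<in>{..Suc n}. t [^] j \<otimes> ?c j) =
          (\<Oplus>j\<in>{..Suc n}. t [^] j \<otimes> c j \<otimes> y \<oplus> t [^] j \<otimes> s j \<otimes> b)"
        using t y b by (intro add.finprod_cong') (auto simp: r_distr m_assoc simp del: nat_pow_Suc)
      also have "\<dots> = (\<Oplus>j\<in>{..Suc n}. t [^] j \<otimes> c j \<otimes> y) \<oplus> (\<Oplus>j\<in>{..Suc n}. t [^] j \<otimes> s j \<otimes> b)"
        using t y b by (intro add.finprod_multf) auto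
      also have "(\<Oplus>j\<in>{..Suc n}. t [^] j \<otimes> c j \<otimes> y) = (\<Oplus>j\<in>{..Suc n}. t [^] j \<otimes> c j) \<otimes> y"
        using t y by (intro finsum_ldistr[symmetric]) auto
      also have "(\<Oplus>j\<in>{..Suc n}. t [^] j \<otimes> s j \<otimes> b) = (\<Oplus>j\<in>{..Suc n}. t [^] j \<otimes> s j) \<otimes> b"
        using t b by (intro finsum_ldistr[symmetric]) auto
      also have "(\<Oplus>j\<in>{..Suc n}. t [^] j \<otimes> c j) \<otimes> y \<oplus> (\<Oplus>j\<in>{..Suc n}. t [^] j \<otimes> s j) \<otimes> b
          = ?S \<otimes> (y \<oplus> t \<otimes> b)"
      proof -
        have "u \<otimes> y \<oplus> t \<otimes> u \<otimes> b = u \<otimes> (y \<oplus> t \<otimes> b)" if "u \<in> carrier R" for u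
          using that t y b by (simp add: r_distr m_ac)
        from this[OF S] show ?thesis unfolding 1 2 .
      qed
      also have "\<dots> = (y \<oplus> t \<otimes> b) [^] Suc n" using c(5)[OF t] by simp
      finally show ?thesis by (rule sym)
    qed
    moreover have "?c 0 = y [^] Suc n" using c(2) y b by (simp add: s_def)
    moreover have "?c j = \<zero>" if "j > Suc n" for j
      using that c(4)[of j] c(4)[of "j - 1"] y b by (cases j) (simp_all add: s_def)
    ultimately show ?case using one y b by (intro bexI[of _ ?c] conjI allI impI ballI) auto
  qed
  then show ?thesis by blast
qed

text \<open>Differences of powers of two thereby become integer multiples of \<open>\<one>\<close>,
  to which divisibility over the rationals applies.\<close>

lemma one_plus_one_pow: "(\<one> \<oplus> \<one>) [^] (i::nat) = add_pow R ((2::nat) ^ i) \<one>"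
proof (induction i)
  case (Suc i)
  have "(\<one> \<oplus> \<one>) [^] Suc i = add_pow R ((2::nat) ^ i) \<one> \<oplus> add_pow R ((2::nat) ^ i) \<one>"
    using Suc by (simp add: r_distr)
  also have "\<dots> = add_pow R ((2::nat) ^ i + 2 ^ i) \<one>" by (rule add.nat_pow_mult) simp
  finally show ?case by (simp add: mult_2)
qed simp

text \<open>Polarisation, one factor at a time: \<open>p y\<^sup>n\<close> is in \<open>K\<close> for all \<open>y\<close> in \<open>I\<close>, hence so is
  \<open>n p b y\<^sup>n\<^sup>-\<^sup>1\<close>, the linear coefficient of \<open>p (y + t b)\<^sup>n\<close>.\<close>

lemma ideal_pow_subset_if_powers:
  assumes I: "ideal I R" and K: "ideal K R"
    and div: "\<And>(n::nat) c. 0 < n \<Longrightarrow> c \<in> carrier R \<Longrightarrow> [n] \<cdot> c \<in> K \<Longrightarrow> c \<in> K"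
    and pow: "\<And>a. a \<in> I \<Longrightarrow> a [^] d \<in> K"
  shows "ideal_pow I d \<subseteq> K"
proof -
  interpret I: ideal I R by fact
  interpret K: ideal K R by fact
  \<comment> \<open>Distinct powers of two differ by a nonzero integer, so \<open>div\<close>
    cancels their differences modulo \<open>K\<close>, as the elimination of coefficients
    requires.\<close>
  define u where "u = \<one> \<oplus> \<one>"
  have u: "u \<in> carrier R" by (simp add: u_def)
  have reg: "c \<in> K" if "i < j" and c: "c \<in> carrier R" and m: "(u [^] i \<ominus> u [^] j) \<otimes> c \<in> K"
    for i j :: nat and c
  proof -
    define k where "k = (2::nat) ^ j - 2 ^ i"
    have j: "(2::nat) ^ j = 2 ^ i + k" and "0 < k" using \<open>i < j\<close> by (simp_all add: k_def)
    have "u [^] j = u [^] i \<oplus> [k] \<cdot> \<one>"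
      unfolding u_def one_plus_one_pow j by (rule add.nat_pow_mult[symmetric]) simp
    then have "u [^] i \<ominus> u [^] j = \<ominus> ([k] \<cdot> \<one>)"
      using u by (simp add: minus_eq minus_add a_assoc[symmetric] r_neg)
    then have "\<ominus> ([k] \<cdot> c) \<in> K" using m c by (simp add: l_minus add_pow_ldistr)
    then have "[k] \<cdot> c \<in> K" using K.a_inv_closed c by fastforce
    then show ?thesis using div[OF \<open>0 < k\<close> c] by blast
  qed
  \<comment> \<open>Here \<open>k\<close> counts the factors that are already arbitrary elements of
    \<open>I\<close>: \<open>k = 0\<close> is \<open>pow\<close>, and at \<open>k = d\<close> the
    power of \<open>y\<close> is \<open>\<one>\<close>, so the claim follows with
    \<open>y = \<zero>\<close>.\<close>
  have step: "p \<otimes> y [^] (d - k) \<in> K" if "k \<le> d" "p \<in> ideal_pow I k" "y \<in> I" for k p y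
    using that
  proof (induction k arbitrary: p y)
    case 0
    then show ?case using pow K.I_l_closed by (simp add: ideal_pow_0)
  next
    case (Suc k)
    define n where "n = d - k"
    have n: "0 < n" "d - Suc k = n - 1" using Suc.prems(1) by (auto simp: n_def)
    have y: "y \<in> carrier R" using Suc.prems(3) by simp
    have "p \<in> ideal_pow I k \<cdot> I" using Suc.prems(2) by (simp add: ideal_pow_Suc)
    then have "p \<in> carrier R \<and> p \<otimes> y [^] (n - 1) \<in> K"
    proof (induction p rule: ideal_prod.induct)
      case (prod q b)
      have q: "q \<in> carrier R" using ideal_pow_carrier[OF I prod(1)] .
      have b: "b \<in> carrier R" using prod(2) by simp
      obtain c where c: "c \<in> UNIV \<rightarrow> carrier R" "c 1 = [n] \<cdot> (b \<otimes> y [^] (n - 1))"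
        "\<And>t. t \<in> carrier R \<Longrightarrow> (y \<oplus> t \<otimes> b) [^] n = (\<Oplus>j\<in>{..n}. t [^] j \<otimes> c j)"
        using binomial_linear_term[OF y b] by blast
      have cc: "c j \<in> carrier R" for j using c(1) by auto
      have "q \<otimes> c 1 \<in> K"
      \<comment> \<open>For fixed \<open>q\<close> in \<open>I^k\<close>, the polynomial
        \<open>q (y + t b)^n\<close> takes values in \<open>K\<close> by the outer induction
        hypothesis, because \<open>y + t b\<close> stays in \<open>I\<close>.\<close>
      proof (rule polynomial_coeffs_in_ideal[OF K u reg, where c = "\<lambda>j. q \<otimes> c j" and m = n])
        fix t assume t: "t \<in> carrier R"
        have "(\<Oplus>j\<in>{..n}. t [^] j \<otimes> (q \<otimes> c j)) = (\<Oplus>j\<in>{..n}. q \<otimes> (t [^] j \<otimes> c j))"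
          using t q cc by (intro add.finprod_cong') (auto simp: m_lcomm)
        also have "\<dots> = q \<otimes> (\<Oplus>j\<in>{..n}. t [^] j \<otimes> c j)"
          using t q cc by (intro finsum_rdistr[symmetric]) auto
        also have "\<dots> = q \<otimes> (y \<oplus> t \<otimes> b) [^] n" using c(3)[OF t] by simp
        also have "\<dots> \<in> K" unfolding n_def
          using Suc prod t by (intro Suc.IH) (auto intro!: I.a_closed I.I_l_closed)
        finally show "(\<Oplus>j\<in>{..n}. t [^] j \<otimes> (q \<otimes> c j)) \<in> K" .
      qed (use q cc n in auto)
      also have "q \<otimes> c 1 = [n] \<cdot> (q \<otimes> b \<otimes> y [^] (n - 1))"
        unfolding c(2) using q b y by (simp add: add_pow_rdistr m_assoc)
      finally have m: "[n] \<cdot> (q \<otimes> b \<otimes> y [^] (n - 1)) \<in> K" .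
      have "q \<otimes> b \<otimes> y [^] (n - 1) \<in> K" by (rule div[OF n(1) _ m]) (use q b y in simp)
      then show ?case using q b by simp
    next
      case (sum p q)
      then show ?case using y by (simp add: l_distr K.a_closed)
    qed
    then show ?case by (simp add: n(2))
  qed
  show ?thesis
  proof
    fix p assume p: "p \<in> ideal_pow I d"
    show "p \<in> K" using step[OF order_refl p I.zero_closed] ideal_pow_carrier[OF I p] by simp
  qed
qed

section \<open>Consequences of containing the rationals\<close>

text \<open>The image of \<open>1 / n\<close> inverts \<open>[n] \<cdot> \<one>\<close>, and
  \<open>K\<close> absorbs multiplication by it.\<close>

lemma contains_rationals_divisible:
  fixes n :: nat
  assumes "contains_rationals R" and K: "ideal K R"
    and "0 < n" and c: "c \<in> carrier R" and nc: "[n] \<cdot> c \<in> K"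
  shows "c \<in> K"
proof -
  obtain f where f: "f \<in> ring_hom rat_ring R" using assms(1) unfolding contains_rationals_def by blast
  have fc: "f q \<in> carrier R" for q using ring_hom_closed[OF f] by (simp add: rat_ring_def)
  have fm: "f (p * q) = f p \<otimes> f q" and fa: "f (p + q) = f p \<oplus> f q" and f1: "f 1 = \<one>" for p q
    using ring_hom_mult[OF f, of p q] ring_hom_add[OF f, of p q] ring_hom_one[OF f] by (simp_all add: rat_ring_def)
  have f0: "f 0 = \<zero>" using fa[of 0 0] fc[of 0] by (metis add.r_cancel_one' add.one_closed add_0)
  have fn: "f (of_nat m) = [m] \<cdot> \<one>" for m by (induction m) (simp_all add: f0 fa f1 a_comm)
  have "f (1 / of_nat n) \<otimes> ([n] \<cdot> c) = f (1 / of_nat n) \<otimes> (f (of_nat n) \<otimes> c)"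
    using c fc by (simp add: fn add_pow_ldistr)
  also have "\<dots> = f (1 / of_nat n * of_nat n) \<otimes> c" using c fc by (simp only: fm m_assoc)
  also have "\<dots> = c" using \<open>0 < n\<close> c f1 by simp
  finally show ?thesis using ideal.I_l_closed[OF K nc fc] by metis
qed

text \<open>In the zero ring a map from the rationals cannot be injective. Nontriviality makes
  \<open>\<one>\<close> admissible as a leading coefficient, which must be nonzero for
  \<open>polynomial\<close>.\<close>

lemma contains_rationals_nontrivial: "contains_rationals R \<Longrightarrow> \<one> \<noteq> \<zero>"
proof
  assume "contains_rationals R" and z: "\<one> = \<zero>"
  then obtain f where f: "f \<in> ring_hom rat_ring R" "inj f" unfolding contains_rationals_def by blast
  have "f q = \<zero>" for q
    using ring_hom_closed[OF f(1), of q] z by (metis UNIV_I l_one l_null partial_object.select_convs(1) rat_ring_def)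
  then have "f 0 = f 1" by simp
  then show False using f(2) by (simp add: inj_eq)
qed

section \<open>Fractions of elements of an ideal\<close>

text \<open>The ideal \<open>(y 0, ..., y (m - 1))\<close>. The last generator is split off first,
  matching coefficient lists that start with the leading coefficient.\<close>

primrec chain_ideal :: "(nat \<Rightarrow> 'a) \<Rightarrow> nat \<Rightarrow> 'a set" where
  "chain_ideal y 0 = {\<zero>}"
| "chain_ideal y (Suc m) = (PIdl (y m)) <+> chain_ideal y m"

lemma chain_ideal_ideal: "y \<in> UNIV \<rightarrow> carrier R \<Longrightarrow> ideal (chain_ideal y m) R"
  by (induction m) (auto intro!: zeroideal add_ideals cgenideal_ideal)

lemma chain_ideal_SucE:
  assumes "z \<in> chain_ideal y (Suc m)"
  obtains c w where "c \<in> carrier R" "w \<in> chain_ideal y m" "z = c \<otimes> y m \<oplus> w"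
  using assms by (auto simp: set_add_def' cgenideal_def)

lemma chain_ideal_SucI:
  "c \<in> carrier R \<Longrightarrow> w \<in> chain_ideal y m \<Longrightarrow> c \<otimes> y m \<oplus> w \<in> chain_ideal y (Suc m)"
  by (auto simp: set_add_def' cgenideal_def)

lemma chain_ideal_mono:
  assumes y: "y \<in> UNIV \<rightarrow> carrier R"
  shows "mono (chain_ideal y)"
proof (rule incseq_SucI, rule subsetI)
  fix m z assume z: "z \<in> chain_ideal y m"
  have "y m \<in> carrier R" "z \<in> carrier R" using y z ideal.Icarr[OF chain_ideal_ideal[OF y]] by auto
  then show "z \<in> chain_ideal y (Suc m)" using chain_ideal_SucI[OF zero_closed z] by simp
qed

text \<open>The union of the chain is one of its members, so some term is a combination of its
  predecessors. The bound \<open>m \<ge> 1\<close> is there because integrality asks for an equation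
  of positive degree.\<close>

lemma chain_ideal_stops:
  assumes y: "y \<in> UNIV \<rightarrow> carrier R" and "noetherian_ring R"
  shows "\<exists>m\<ge>1. y m \<in> chain_ideal y m"
proof -
  interpret noetherian_ring R by fact
  have "subset.chain {I. ideal I R} (range (chain_ideal y))"
    unfolding subset_chain_def
  proof (intro conjI ballI)
    show "range (chain_ideal y) \<subseteq> {I. ideal I R}" using chain_ideal_ideal[OF y] by auto
    fix J L assume "J \<in> range (chain_ideal y)" "L \<in> range (chain_ideal y)"
    then obtain i j where "J = chain_ideal y i" "L = chain_ideal y j" by blast
    then show "J \<subseteq> L \<or> L \<subseteq> J"
      using monoD[OF chain_ideal_mono[OF y]] nat_le_linear[of i j] by blast
  qed
  then have "\<Union> (range (chain_ideal y)) \<in> range (chain_ideal y)"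
    by (intro ideal_chain_is_trivial) auto
  then obtain m where m: "\<Union> (range (chain_ideal y)) = chain_ideal y m" by blast
  have yc: "y (Suc m) \<in> carrier R" using y by auto
  have "y (Suc m) \<in> chain_ideal y (Suc (Suc m))"
    using chain_ideal_SucI[OF one_closed, of \<zero> y "Suc m"] yc
      additive_subgroup.zero_closed[OF ideal.axioms(1)[OF chain_ideal_ideal[OF y]]]
    by (simp del: chain_ideal.simps)
  then have "y (Suc m) \<in> chain_ideal y m" using m by blast
  then have "y (Suc m) \<in> chain_ideal y (Suc m)"
    using monoD[OF chain_ideal_mono[OF y], of m "Suc m"] by auto
  \<comment> \<open>Passing to \<open>Suc m\<close> keeps the index positive even if the chain is
    already stationary at \<open>0\<close>.\<close>
  then show ?thesis by (intro exI[of _ "Suc m"]) simp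
qed

section \<open>Integrality of the fraction \<open>a / x\<close> and clearing its denominator\<close>

lemma frac_one_regular_Unit:
  assumes "x \<in> regular_elements R"
  shows "frac R x \<one> \<in> Units (total_quotient_ring R)"
proof -
  interpret Q: cring "total_quotient_ring R" by (rule total_quotient_ring_cring)
  have "x \<in> carrier R" using assms by (rule regular_elements_carrier)
  then show ?thesis
    using regular_becomes_unit[OF assms] assms Q.m_comm[of "frac R x \<one>" "frac R \<one> x"]
    unfolding Units_def by (auto intro!: bexI[of _ "frac R \<one> x"] frac_closed one_regular)
qed

lemma frac_eq_mult:
  assumes "a \<in> carrier R" "x \<in> regular_elements R"
  shows "frac R a \<one> = frac R x \<one> \<otimes>\<^bsub>total_quotient_ring R\<^esub> frac R a x"
proof -
  have "x \<in> carrier R" using assms(2) by (rule regular_elements_carrier)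
  then show ?thesis using assms by (simp add: frac_mult one_regular frac_eq_iff m_ac regular_elements_closed)
qed

text \<open>Cancelling \<open>x^k\<close> in the total quotient ring gives
  \<open>y k = x^r (a / x)^k\<close>. A relation expressing \<open>y m\<close> by its predecessors,
  divided by \<open>x^r\<close>, is therefore a monic equation of degree \<open>m\<close>.\<close>

lemma frac_integral:
  fixes r :: nat
  assumes a: "a \<in> carrier R" and x: "x \<in> regular_elements R" and "\<one> \<noteq> \<zero>"
    and y: "y \<in> UNIV \<rightarrow> carrier R"
    and yk: "\<And>k::nat. x [^] k \<otimes> y k = x [^] r \<otimes> a [^] k"
    and ym: "y m \<in> chain_ideal y m"
  shows "monic_equation (total_quotient_ring R) (base_image R) (frac R a x) m"
proof -
  let ?Q = "total_quotient_ring R"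
  interpret Q: cring ?Q by (rule total_quotient_ring_cring)
  interpret h: ring_hom_cring R ?Q "\<lambda>a. frac R a \<one>"
    using frac_one_hom by (intro ring_hom_cring.intro ring_hom_cring_axioms.intro cring_axioms Q.cring_axioms)
  define t b where "t = frac R x \<one>" and "b = frac R a x"
  have xc: "x \<in> carrier R" using x by (rule regular_elements_carrier)
  have t: "t \<in> Units ?Q" unfolding t_def by (rule frac_one_regular_Unit[OF x])
  have tc [simp]: "t \<in> carrier ?Q" using t by (rule Q.Units_closed)
  have bc [simp]: "b \<in> carrier ?Q" unfolding b_def by (rule frac_closed[OF a x])
  have tb: "t \<otimes>\<^bsub>?Q\<^esub> b = frac R a \<one>" unfolding t_def b_def by (rule frac_eq_mult[OF a x, symmetric])
  have tk: "t [^]\<^bsub>?Q\<^esub> (k::nat) \<in> Units ?Q" for k using t by (rule Q.Units_pow_closed)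
  have K: "base_image R \<subseteq> carrier ?Q" by (auto simp: base_image_def)
  have fy: "frac R (y k) \<one> = t [^]\<^bsub>?Q\<^esub> r \<otimes>\<^bsub>?Q\<^esub> b [^]\<^bsub>?Q\<^esub> k" for k
  proof -
    have yc: "y k \<in> carrier R" using y by auto
    have "t [^]\<^bsub>?Q\<^esub> k \<otimes>\<^bsub>?Q\<^esub> frac R (y k) \<one> = frac R (x [^] k \<otimes> y k) \<one>"
      using xc yc by (simp add: t_def h.ring.hom_nat_pow)
    also have "\<dots> = t [^]\<^bsub>?Q\<^esub> r \<otimes>\<^bsub>?Q\<^esub> (t \<otimes>\<^bsub>?Q\<^esub> b) [^]\<^bsub>?Q\<^esub> k"
      unfolding yk tb using xc a by (simp add: h.ring.hom_nat_pow t_def)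
    also have "\<dots> = t [^]\<^bsub>?Q\<^esub> k \<otimes>\<^bsub>?Q\<^esub> (t [^]\<^bsub>?Q\<^esub> r \<otimes>\<^bsub>?Q\<^esub> b [^]\<^bsub>?Q\<^esub> k)"
      by (simp add: Q.nat_pow_distrib Q.m_ac)
    finally show ?thesis using Q.Units_l_cancel[OF tk] yc by simp
  qed
  \<comment> \<open>Members of the chain ideal are read as \<open>x^r\<close> times the value of a
    coefficient list. The list may start with zeros, so it is only evaluated and not claimed to be a
    \<open>polynomial\<close>.\<close>
  have ex: "\<exists>q. set q \<subseteq> base_image R \<and> length q = m \<and>
      frac R z \<one> = t [^]\<^bsub>?Q\<^esub> r \<otimes>\<^bsub>?Q\<^esub> Q.eval q b" if "z \<in> chain_ideal y m" for z m
    using that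
  proof (induction m arbitrary: z)
    case 0
    then show ?case by (intro exI[of _ "[]"]) simp
  next
    case (Suc m)
    then obtain c w where cw: "c \<in> carrier R" "w \<in> chain_ideal y m" "z = c \<otimes> y m \<oplus> w"
      by (metis chain_ideal_SucE)
    then obtain q where q: "set q \<subseteq> base_image R" "length q = m"
      "frac R w \<one> = t [^]\<^bsub>?Q\<^esub> r \<otimes>\<^bsub>?Q\<^esub> Q.eval q b" using Suc.IH by blast
    have c: "y m \<in> carrier R" "w \<in> carrier R" "Q.eval q b \<in> carrier ?Q"
      using y cw(2) ideal.Icarr[OF chain_ideal_ideal[OF y]] Q.eval_in_carrier q K by auto
    have "frac R z \<one> = frac R c \<one> \<otimes>\<^bsub>?Q\<^esub> (t [^]\<^bsub>?Q\<^esub> r \<otimes>\<^bsub>?Q\<^esub> b [^]\<^bsub>?Q\<^esub> m)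
        \<oplus>\<^bsub>?Q\<^esub> t [^]\<^bsub>?Q\<^esub> r \<otimes>\<^bsub>?Q\<^esub> Q.eval q b"
      using cw c by (simp add: fy q(3))
    also have "\<dots> = t [^]\<^bsub>?Q\<^esub> r \<otimes>\<^bsub>?Q\<^esub> Q.eval (frac R c \<one> # q) b"
      using cw c q(2) by (simp add: Q.r_distr Q.m_ac)
    finally show ?case using cw(1) q by (intro exI[of _ "frac R c \<one> # q"]) (simp add: base_image_def)
  qed
  interpret Z: ideal "chain_ideal y m" R by (rule chain_ideal_ideal[OF y])
  \<comment> \<open>The negative of \<open>y m\<close> is expanded, so that its list can follow the
    leading coefficient \<open>\<one>\<close> unchanged.\<close>
  obtain q where q: "set q \<subseteq> base_image R" "length q = m"
    "frac R (\<ominus> y m) \<one> = t [^]\<^bsub>?Q\<^esub> r \<otimes>\<^bsub>?Q\<^esub> Q.eval q b"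
    using ex[of "\<ominus> y m" m] ym by auto
  have qc: "Q.eval q b \<in> carrier ?Q" using Q.eval_in_carrier q K by auto
  have yc: "y m \<in> carrier R" using y by auto
  have "t [^]\<^bsub>?Q\<^esub> r \<otimes>\<^bsub>?Q\<^esub> (b [^]\<^bsub>?Q\<^esub> m \<oplus>\<^bsub>?Q\<^esub> Q.eval q b) = frac R (y m) \<one> \<oplus>\<^bsub>?Q\<^esub> frac R (\<ominus> y m) \<one>"
    unfolding q(3) fy using qc by (simp add: Q.r_distr)
  also have "\<dots> = t [^]\<^bsub>?Q\<^esub> r \<otimes>\<^bsub>?Q\<^esub> \<zero>\<^bsub>?Q\<^esub>" using yc by (simp add: Q.r_neg)
  finally have "b [^]\<^bsub>?Q\<^esub> m \<oplus>\<^bsub>?Q\<^esub> Q.eval q b = \<zero>\<^bsub>?Q\<^esub>"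
    using qc by (simp only: Q.Units_l_cancel[OF tk] Q.a_closed Q.nat_pow_closed bc Q.zero_closed)
  then have "Q.eval (\<one>\<^bsub>?Q\<^esub> # q) b = \<zero>\<^bsub>?Q\<^esub>" using q(2) by simp
  moreover have "\<one>\<^bsub>?Q\<^esub> \<noteq> \<zero>\<^bsub>?Q\<^esub>"
    using inj_on_eq_iff[OF frac_one_inj, of \<one> \<zero>] \<open>\<one> \<noteq> \<zero>\<close> by simp
  moreover have "\<one>\<^bsub>?Q\<^esub> \<in> base_image R" unfolding base_image_def total_quotient_ring_one by blast
  ultimately show ?thesis unfolding monic_equation_def b_def using q
    by (intro bexI[of _ "\<one>\<^bsub>?Q\<^esub> # q"]) (auto simp: univ_poly_carrier[symmetric] polynomial_def)
qed

text \<open>Multiplication by \<open>x^(e+1)\<close> turns the leading term into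
  \<open>a^(e+1)\<close> and a term \<open>c (a / x)^k\<close> with \<open>k \<le> e\<close> into
  \<open>c x (x^(e-k) a^k)\<close>, which lies in \<open>x I^e\<close>.\<close>

lemma monic_equation_clear_denominators:
  assumes I: "ideal I R" and aI: "a \<in> I" and xI: "x \<in> I" and x: "x \<in> regular_elements R"
    and mon: "monic_equation (total_quotient_ring R) (base_image R) (frac R a x) (Suc e)"
  shows "a [^] Suc e \<in> (\<lambda>z. x \<otimes> z) ` ideal_pow I e"
proof -
  let ?Q = "total_quotient_ring R"
  interpret Q: cring ?Q by (rule total_quotient_ring_cring)
  interpret h: ring_hom_cring R ?Q "\<lambda>a. frac R a \<one>"
    using frac_one_hom by (intro ring_hom_cring.intro ring_hom_cring_axioms.intro cring_axioms Q.cring_axioms)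
  interpret L: ideal "(\<lambda>z. x \<otimes> z) ` ideal_pow I e" R
    using regular_elements_carrier[OF x] by (intro principal_mult_ideal ideal_pow_ideal I)
  define t b where "t = frac R x \<one>" and "b = frac R a x"
  have xc: "x \<in> carrier R" using x by (rule regular_elements_carrier)
  have a: "a \<in> carrier R" using ideal.Icarr[OF I aI] .
  have tc [simp]: "t \<in> carrier ?Q" unfolding t_def using xc by simp
  have bc [simp]: "b \<in> carrier ?Q" unfolding b_def by (rule frac_closed[OF a x])
  have tb: "t \<otimes>\<^bsub>?Q\<^esub> b = frac R a \<one>" unfolding t_def b_def by (rule frac_eq_mult[OF a x, symmetric])
  have K: "base_image R \<subseteq> carrier ?Q" by (auto simp: base_image_def)
  \<comment> \<open>The bound on the length keeps every exponent at most \<open>e\<close>, so one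
    factor \<open>x\<close> is always left over.\<close>
  have low: "\<exists>z \<in> (\<lambda>z. x \<otimes> z) ` ideal_pow I e. t [^]\<^bsub>?Q\<^esub> Suc e \<otimes>\<^bsub>?Q\<^esub> Q.eval q b = frac R z \<one>"
    if "set q \<subseteq> base_image R" "length q \<le> Suc e" for q
    using that
  proof (induction q)
    case Nil
    have "t [^]\<^bsub>?Q\<^esub> Suc e \<otimes>\<^bsub>?Q\<^esub> Q.eval [] b = frac R \<zero> \<one>"
      by (simp add: total_quotient_ring_zero[symmetric] del: Q.nat_pow_Suc)
    then show ?case using L.zero_closed by blast
  next
    case (Cons c q)
    define k where "k = length q"
    have k: "k \<le> e" using Cons.prems(2) by (simp add: k_def)
    obtain z where z: "z \<in> (\<lambda>z. x \<otimes> z) ` ideal_pow I e"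
      "t [^]\<^bsub>?Q\<^esub> Suc e \<otimes>\<^bsub>?Q\<^esub> Q.eval q b = frac R z \<one>"
      using Cons by auto
    obtain c' where c': "c' \<in> carrier R" "c = frac R c' \<one>"
      using Cons.prems(1) by (auto simp: base_image_def)
    have qc: "Q.eval q b \<in> carrier ?Q" using Q.eval_in_carrier Cons.prems K by auto
    have "x [^] (e - k) \<otimes> a [^] k \<in> ideal_pow I (e - k + k)"
      by (intro ideal_pow_mult ideal_pow_elem I aI xI)
    then have "c' \<otimes> (x \<otimes> (x [^] (e - k) \<otimes> a [^] k)) \<in> (\<lambda>z. x \<otimes> z) ` ideal_pow I e"
      using k c'(1) by (auto intro: L.I_l_closed[OF imageI])
    then have m: "c' \<otimes> (x \<otimes> (x [^] (e - k) \<otimes> a [^] k)) \<oplus> z \<in> (\<lambda>z. x \<otimes> z) ` ideal_pow I e"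
      using z(1) by (rule L.a_closed)
    have zc: "z \<in> carrier R" using z(1) by (rule L.Icarr)
    have "t [^]\<^bsub>?Q\<^esub> Suc e = t \<otimes>\<^bsub>?Q\<^esub> (t [^]\<^bsub>?Q\<^esub> (e - k) \<otimes>\<^bsub>?Q\<^esub> t [^]\<^bsub>?Q\<^esub> k)"
      using k by (simp add: Q.nat_pow_mult Q.m_comm)
    then have "t [^]\<^bsub>?Q\<^esub> Suc e \<otimes>\<^bsub>?Q\<^esub> (c \<otimes>\<^bsub>?Q\<^esub> b [^]\<^bsub>?Q\<^esub> k)
        = c \<otimes>\<^bsub>?Q\<^esub> (t \<otimes>\<^bsub>?Q\<^esub> (t [^]\<^bsub>?Q\<^esub> (e - k) \<otimes>\<^bsub>?Q\<^esub> (t \<otimes>\<^bsub>?Q\<^esub> b) [^]\<^bsub>?Q\<^esub> k))"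
      using c' by (simp add: Q.nat_pow_distrib Q.m_ac)
    also have "\<dots> = frac R (c' \<otimes> (x \<otimes> (x [^] (e - k) \<otimes> a [^] k))) \<one>"
      unfolding tb using c' xc a by (simp add: t_def h.ring.hom_nat_pow)
    finally have "t [^]\<^bsub>?Q\<^esub> Suc e \<otimes>\<^bsub>?Q\<^esub> (c \<otimes>\<^bsub>?Q\<^esub> b [^]\<^bsub>?Q\<^esub> k) \<oplus>\<^bsub>?Q\<^esub> t [^]\<^bsub>?Q\<^esub> Suc e \<otimes>\<^bsub>?Q\<^esub> Q.eval q b
        = frac R (c' \<otimes> (x \<otimes> (x [^] (e - k) \<otimes> a [^] k)) \<oplus> z) \<one>"
      unfolding z(2) using c'(1) xc a zc by simp
    moreover have "t [^]\<^bsub>?Q\<^esub> Suc e \<otimes>\<^bsub>?Q\<^esub> Q.eval (c # q) b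
        = t [^]\<^bsub>?Q\<^esub> Suc e \<otimes>\<^bsub>?Q\<^esub> (c \<otimes>\<^bsub>?Q\<^esub> b [^]\<^bsub>?Q\<^esub> k) \<oplus>\<^bsub>?Q\<^esub> t [^]\<^bsub>?Q\<^esub> Suc e \<otimes>\<^bsub>?Q\<^esub> Q.eval q b"
      using c' qc by (simp add: k_def Q.r_distr del: Q.nat_pow_Suc)
    ultimately show ?case using m by metis
  qed
  obtain p where p: "polynomial\<^bsub>?Q\<^esub> (base_image R) p" "p \<noteq> []" "hd p = \<one>\<^bsub>?Q\<^esub>" "length p - 1 = Suc e"
    "Q.eval p b = \<zero>\<^bsub>?Q\<^esub>"
    using mon univ_poly_carrier[of ?Q "base_image R"] unfolding monic_equation_def b_def by blast
  then obtain q where pq: "p = \<one>\<^bsub>?Q\<^esub> # q" by (cases p) auto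
  have q: "set q \<subseteq> base_image R" "length q = Suc e" using p pq by (auto simp: polynomial_def)
  obtain z where z: "z \<in> (\<lambda>z. x \<otimes> z) ` ideal_pow I e"
    "t [^]\<^bsub>?Q\<^esub> Suc e \<otimes>\<^bsub>?Q\<^esub> Q.eval q b = frac R z \<one>" using low q by (metis order_refl)
  have zc: "z \<in> carrier R" using z(1) by (rule L.Icarr)
  have qc: "Q.eval q b \<in> carrier ?Q" using Q.eval_in_carrier q K by auto
  have "frac R (a [^] Suc e \<oplus> z) \<one> = (t \<otimes>\<^bsub>?Q\<^esub> b) [^]\<^bsub>?Q\<^esub> Suc e \<oplus>\<^bsub>?Q\<^esub> t [^]\<^bsub>?Q\<^esub> Suc e \<otimes>\<^bsub>?Q\<^esub> Q.eval q b"
    unfolding tb z(2) using a zc by (simp add: h.ring.hom_nat_pow)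
  also have "\<dots> = t [^]\<^bsub>?Q\<^esub> Suc e \<otimes>\<^bsub>?Q\<^esub> Q.eval p b"
    using qc q(2) by (simp add: pq Q.nat_pow_distrib Q.r_distr Q.m_ac)
  also have "\<dots> = frac R \<zero> \<one>" by (simp add: p(5) total_quotient_ring_zero[symmetric] del: Q.nat_pow_Suc)
  \<comment> \<open>The equation returns to the base ring because the map into the total quotient
    ring is injective.\<close>
  finally have "a [^] Suc e \<oplus> z = \<zero>" by (rule inj_onD[OF frac_one_inj]) (use a zc in auto)
  then have "a [^] Suc e = \<ominus> z" using a zc by (intro minus_equality[symmetric]) auto
  then show ?thesis using z(1) by simp
qed

section \<open>The reduction number\<close>

text \<open>This bounds the reduction number of \<open>I\<close> with respect to \<open>(x)\<close>
  by \<open>d - 1\<close>. Integrality of the fractions \<open>a / x\<close> supplies the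
  \<open>d\<close>-th powers, and polarisation passes from these to all of
  \<open>I^d\<close>.\<close>

lemma reduction_number_less_integral_degree:
  assumes noeth: "noetherian_ring R" and rat: "contains_rationals R" and deg: "integral_degree R = enat d"
    and reg: "regular_ideal R I" and x: "x \<in> carrier R" and red: "reduction R (Idl {x}) I"
  obtains e where "d = Suc e" "ideal_pow I d \<subseteq> (\<lambda>z. x \<otimes> z) ` ideal_pow I e"
proof -
  let ?Q = "total_quotient_ring R"
  have I: "ideal I R" using reg by (simp add: regular_ideal_def)
  interpret I: ideal I R by fact
  have xI: "x \<in> I" using red genideal_self'[OF x] by (auto simp: reduction_def)
  obtain r where "ideal_pow I (Suc r) = (Idl {x}) \<cdot> ideal_pow I r"
    using red by (auto simp: reduction_def)
  then have r: "ideal_pow I (Suc r) \<subseteq> (\<lambda>z. x \<otimes> z) ` ideal_pow I r"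
    using ideal_prod_principal[OF x ideal_pow_ideal[OF I]] by auto
  obtain s where s: "s \<in> I" "s \<in> regular_elements R" using reg by (auto simp: regular_ideal_def)
  have sk: "s [^] (k::nat) \<in> regular_elements R" for k
    using s(2) by (induction k) (simp_all add: one_regular regular_elements_closed)
  \<comment> \<open>A power of the regular element \<open>s\<close> is a multiple of
    \<open>x\<close>, and a divisor of a regular element is regular.\<close>
  obtain z where z: "z \<in> ideal_pow I r" "s [^] Suc r = x \<otimes> z" using ideal_pow_elem[OF I s(1)] r by blast
  have zc: "z \<in> carrier R" using ideal_pow_carrier[OF I z(1)] .
  have xr: "x \<in> regular_elements R"
    unfolding regular_elements_def
  proof (intro CollectI conjI ballI impI)
    fix c assume c: "c \<in> carrier R" "x \<otimes> c = \<zero>"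
    have "s [^] Suc r \<otimes> c = z \<otimes> (x \<otimes> c)" unfolding z(2) using x zc c(1) by (simp add: m_ac)
    then have "s [^] Suc r \<otimes> c = \<zero>" using c zc by simp
    then show "c = \<zero>" using sk[of "Suc r"] c(1) unfolding regular_elements_def by blast
  qed (rule x)
  have int: "\<exists>e. monic_equation ?Q (base_image R) (frac R a x) (Suc e) \<and> Suc e \<le> d" if a: "a \<in> I" for a
  proof -
    have ac: "a \<in> carrier R" using a by simp
    \<comment> \<open>The product \<open>x^r a^k\<close> lies in \<open>I^(r+k)\<close>, hence in
      \<open>x^k I^r\<close>, so division by \<open>x^k\<close> stays inside the ring.\<close>
    have "\<exists>y \<in> carrier R. x [^] k \<otimes> y = x [^] r \<otimes> a [^] k" for k :: nat
    proof -
      have "x [^] r \<otimes> a [^] k \<in> ideal_pow I (r + k)"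
        by (intro ideal_pow_mult ideal_pow_elem I a xI)
      then obtain y where "y \<in> ideal_pow I r" "x [^] r \<otimes> a [^] k = x [^] k \<otimes> y"
        using ideal_pow_reduction[OF I x r, of k] by blast
      then show ?thesis using ideal_pow_carrier[OF I] by metis
    qed
    then obtain y where y: "\<And>k. y k \<in> carrier R" "\<And>k::nat. x [^] k \<otimes> y k = x [^] r \<otimes> a [^] k" by metis
    then have y': "y \<in> UNIV \<rightarrow> carrier R" by auto
    obtain m where m: "m \<ge> 1" "y m \<in> chain_ideal y m" using chain_ideal_stops[OF y' noeth] by blast
    have eq: "monic_equation ?Q (base_image R) (frac R a x) m"
      by (rule frac_integral[OF ac xr contains_rationals_nontrivial[OF rat] y' y(2) m(2)])
    \<comment> \<open>The chain condition gives no control over \<open>m\<close>; only the least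
      degree is bounded by the supremum \<open>d\<close>.\<close>
    define k where "k = element_integral_degree ?Q (base_image R) (frac R a x)"
    have k: "k \<ge> 1 \<and> monic_equation ?Q (base_image R) (frac R a x) k"
      unfolding k_def element_integral_degree_def by (rule LeastI[of _ m]) (use m eq in blast)
    have "frac R a x \<in> integral_closure ?Q (base_image R)"
      unfolding integral_closure_def using m eq frac_closed[OF ac xr] by blast
    then have "enat k \<le> integral_degree R"
      unfolding integral_degree_def extension_integral_degree_def k_def by (rule SUP_upper)
    then have "k \<le> d" by (simp add: deg)
    then show ?thesis using k by (intro exI[of _ "k - 1"]) simp
  qed
  \<comment> \<open>Positivity of \<open>d\<close> comes from the fraction \<open>x / x\<close>,
    whose equation has positive degree at most \<open>d\<close>.\<close>
  then obtain e where e: "d = Suc e" using xI by (metis Suc_le_D)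
  have pow: "a [^] d \<in> (\<lambda>z. x \<otimes> z) ` ideal_pow I e" if a: "a \<in> I" for a
  proof -
    have ac: "a \<in> carrier R" using a by simp
    obtain k where k: "monic_equation ?Q (base_image R) (frac R a x) (Suc k)" "k \<le> e"
      using int[OF a] e by auto
    obtain w where w: "w \<in> ideal_pow I k" "a [^] Suc k = x \<otimes> w"
      using monic_equation_clear_denominators[OF I a xI xr k(1)] by blast
    \<comment> \<open>The degree \<open>Suc k\<close> may be smaller than \<open>d\<close>; the
      missing factors are supplied by \<open>a^(e-k)\<close>.\<close>
    have "a [^] d = a [^] Suc k \<otimes> a [^] (e - k)" using ac k(2) e by (simp only: nat_pow_mult) simp
    also have "\<dots> = x \<otimes> (w \<otimes> a [^] (e - k))"
      unfolding w(2) using ac x ideal_pow_carrier[OF I w(1)] by (simp add: m_assoc)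
    finally show ?thesis
      using ideal_pow_mult[OF I w(1) ideal_pow_elem[OF I a], of "e - k"] k(2) by auto
  qed
  have K: "ideal ((\<lambda>z. x \<otimes> z) ` ideal_pow I e) R"
    by (rule principal_mult_ideal[OF x ideal_pow_ideal[OF I]])
  have "ideal_pow I d \<subseteq> (\<lambda>z. x \<otimes> z) ` ideal_pow I e"
    by (rule ideal_pow_subset_if_powers[OF I K contains_rationals_divisible[OF rat K] pow])
  then show thesis using that e by blast
qed

end

section \<open>Modules\<close>

context module
begin

lemma module_span_least: "module_span R M S \<subseteq> H" if "submodule H R M" "S \<subseteq> H"
  using that unfolding module_span_def by blast

lemma module_span_submodule:
  assumes "S \<subseteq> carrier M"
  shows "submodule (module_span R M S) R M"
proof (rule submoduleI)
  show "module_span R M S \<subseteq> carrier M"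
    using module_span_least[OF carrier_is_submodule assms] .
  show "\<zero>\<^bsub>M\<^esub> \<in> module_span R M S"
    unfolding module_span_def using submodule.axioms(1) subgroup.one_closed by fastforce
qed (auto simp: module_span_def submoduleE)

lemma ideal_module_prod_submodule:
  "I \<subseteq> carrier R \<Longrightarrow> H \<subseteq> carrier M \<Longrightarrow> submodule (ideal_module_prod R M I H) R M"
  unfolding ideal_module_prod_def by (rule module_span_submodule) auto

lemma ideal_module_prod_elem: "a \<in> I \<Longrightarrow> h \<in> H \<Longrightarrow> a \<odot>\<^bsub>M\<^esub> h \<in> ideal_module_prod R M I H"
  unfolding ideal_module_prod_def module_span_def by blast

lemma submodule_zero: "submodule H R M \<Longrightarrow> \<zero>\<^bsub>M\<^esub> \<in> H"
  using subgroup.one_closed[OF submodule.axioms(1)] by fastforce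

text \<open>Together with \<open>module_span_least\<close>, this reduces membership of a whole span
  in \<open>a H\<close> to its generators.\<close>

lemma submodule_image_smult:
  assumes H: "submodule H R M" and a: "a \<in> carrier R"
  shows "submodule ((\<lambda>h. a \<odot>\<^bsub>M\<^esub> h) ` H) R M"
proof (rule submoduleI)
  note E = submoduleE[OF H]
  have hc: "h \<in> carrier M" if "h \<in> H" for h using that E(1) by blast
  show "(\<lambda>h. a \<odot>\<^bsub>M\<^esub> h) ` H \<subseteq> carrier M" using a hc by auto
  show "\<zero>\<^bsub>M\<^esub> \<in> (\<lambda>h. a \<odot>\<^bsub>M\<^esub> h) ` H" using submodule_zero[OF H] a by (intro image_eqI[of _ _ "\<zero>\<^bsub>M\<^esub>"]) auto
  fix u assume "u \<in> (\<lambda>h. a \<odot>\<^bsub>M\<^esub> h) ` H"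
  then obtain h where h: "h \<in> H" "u = a \<odot>\<^bsub>M\<^esub> h" by blast
  show "\<ominus>\<^bsub>M\<^esub> u \<in> (\<lambda>h. a \<odot>\<^bsub>M\<^esub> h) ` H"
    using h E(3)[OF h(1)] a hc by (intro image_eqI[of _ _ "\<ominus>\<^bsub>M\<^esub> h"]) (simp_all add: smult_r_minus)
  show "c \<odot>\<^bsub>M\<^esub> u \<in> (\<lambda>h. a \<odot>\<^bsub>M\<^esub> h) ` H" if c: "c \<in> carrier R" for c
  proof (rule image_eqI[of _ _ "c \<odot>\<^bsub>M\<^esub> h"])
    show "c \<odot>\<^bsub>M\<^esub> u = a \<odot>\<^bsub>M\<^esub> (c \<odot>\<^bsub>M\<^esub> h)"
      unfolding h(2) using a c hc[OF h(1)] by (simp add: smult_assoc1[symmetric] R.m_comm)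
  qed (rule E(4)[OF c h(1)])
  fix v assume "v \<in> (\<lambda>h. a \<odot>\<^bsub>M\<^esub> h) ` H"
  then obtain g where g: "g \<in> H" "v = a \<odot>\<^bsub>M\<^esub> g" by blast
  show "u \<oplus>\<^bsub>M\<^esub> v \<in> (\<lambda>h. a \<odot>\<^bsub>M\<^esub> h) ` H"
    using h g E(5)[OF h(1) g(1)] a hc by (intro image_eqI[of _ _ "h \<oplus>\<^bsub>M\<^esub> g"]) (simp_all add: smult_r_distr)
qed

text \<open>Counterpart for preimages: that \<open>a\<close> maps a span into \<open>H\<close> can
  be checked on generators.\<close>

lemma submodule_vimage_smult:
  assumes H: "submodule H R M" and a: "a \<in> carrier R"
  shows "submodule {h \<in> carrier M. a \<odot>\<^bsub>M\<^esub> h \<in> H} R M"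
proof (rule submoduleI)
  note E = submoduleE[OF H]
  show "\<zero>\<^bsub>M\<^esub> \<in> {h \<in> carrier M. a \<odot>\<^bsub>M\<^esub> h \<in> H}" using submodule_zero[OF H] a by simp
  fix u assume u: "u \<in> {h \<in> carrier M. a \<odot>\<^bsub>M\<^esub> h \<in> H}"
  then show "\<ominus>\<^bsub>M\<^esub> u \<in> {h \<in> carrier M. a \<odot>\<^bsub>M\<^esub> h \<in> H}" using E(3) a by (simp add: smult_r_minus)
  show "c \<odot>\<^bsub>M\<^esub> u \<in> {h \<in> carrier M. a \<odot>\<^bsub>M\<^esub> h \<in> H}" if c: "c \<in> carrier R" for c
  proof -
    have "a \<odot>\<^bsub>M\<^esub> (c \<odot>\<^bsub>M\<^esub> u) = c \<odot>\<^bsub>M\<^esub> (a \<odot>\<^bsub>M\<^esub> u)"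
      using a c u by (simp add: smult_assoc1[symmetric] R.m_comm)
    then show ?thesis using E(4)[OF c] c u by simp
  qed
  fix v assume "v \<in> {h \<in> carrier M. a \<odot>\<^bsub>M\<^esub> h \<in> H}"
  then show "u \<oplus>\<^bsub>M\<^esub> v \<in> {h \<in> carrier M. a \<odot>\<^bsub>M\<^esub> h \<in> H}" using u E(5) a by (simp add: smult_r_distr)
qed auto

section \<open>Cancellation modulo \<open>N\<close> and products of ideal powers with
  modules\<close>

text \<open>In the quotient by \<open>N\<close>, the equality of the annihilators of
  \<open>x^2\<close> and \<open>x\<close> removes one factor \<open>x\<close> at a time until a
  single one remains.\<close>

lemma d_sequence_quotient_cancel:
  assumes N: "submodule N R M" and dseq: "d_sequence R (quotient_module R M N) [x]"
    and w: "w \<in> carrier M" and "x [^] Suc m \<odot>\<^bsub>M\<^esub> w \<in> N"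
  shows "x \<odot>\<^bsub>M\<^esub> w \<in> N"
proof -
  let ?L = "quotient_module R M N"
  interpret L: module R ?L by (rule quotient_module_module[OF N])
  interpret S: abelian_subgroup N M by (rule submodule_abelian_subgroup[OF N])
  have x: "x \<in> carrier R"
    and colon: "module_colon ?L {\<zero>\<^bsub>?L\<^esub>} (x \<otimes> x) = module_colon ?L {\<zero>\<^bsub>?L\<^esub>} x"
    using dseq unfolding L.d_sequence_single by auto
  have N0: "N +>\<^bsub>M\<^esub> u = \<zero>\<^bsub>?L\<^esub> \<longleftrightarrow> u \<in> N" if "u \<in> carrier M" for u
  proof
    assume "N +>\<^bsub>M\<^esub> u = \<zero>\<^bsub>?L\<^esub>"
    then show "u \<in> N" using S.a_rcos_self[OF that] by (simp add: quotient_module_def)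
  next
    assume "u \<in> N"
    then show "N +>\<^bsub>M\<^esub> u = \<zero>\<^bsub>?L\<^esub>" using S.a_rcos_const by (simp add: quotient_module_def)
  qed
  have mem: "v \<in> carrier M \<and> a \<odot>\<^bsub>M\<^esub> v \<in> N \<longleftrightarrow> v \<in> carrier M \<and> N +>\<^bsub>M\<^esub> v \<in> module_colon ?L {\<zero>\<^bsub>?L\<^esub>} a"
    if "a \<in> carrier R" for a v
    using that N0[of "a \<odot>\<^bsub>M\<^esub> v"] quotient_smult[OF N, of a v]
    unfolding module_colon_def quotient_module_carrier by (cases "v \<in> carrier M") (simp_all, blast)
  have sq: "x \<odot>\<^bsub>M\<^esub> v \<in> N" if "v \<in> carrier M" "(x \<otimes> x) \<odot>\<^bsub>M\<^esub> v \<in> N" for v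
    using that mem[of "x \<otimes> x" v] mem[of x v] x colon by auto
  show ?thesis using w assms(4)
  proof (induction m arbitrary: w)
    case 0
    then show ?case using x by simp
  next
    case (Suc m)
    \<comment> \<open>The induction hypothesis is applied to \<open>x w\<close>, hence
      \<open>w\<close> is arbitrary; it leaves \<open>x^2 w\<close> in \<open>N\<close>, and
      \<open>sq\<close> removes the second factor.\<close>
    have "x [^] Suc m \<odot>\<^bsub>M\<^esub> (x \<odot>\<^bsub>M\<^esub> w) \<in> N"
      using Suc.prems x by (simp add: smult_assoc1)
    then have "x \<odot>\<^bsub>M\<^esub> (x \<odot>\<^bsub>M\<^esub> w) \<in> N" using Suc.prems(1) x by (intro Suc.IH) auto
    then show ?case using Suc.prems(1) x by (intro sq) (simp_all add: smult_assoc1)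
  qed
qed

text \<open>For fixed \<open>a\<close> in \<open>I^k\<close>, the elements that \<open>a\<close>
  carries into \<open>I^(k+d) M\<close> form a submodule containing the generators
  \<open>b g\<close> of \<open>I^d M\<close>.\<close>

lemma ideal_module_prod_pow_subset:
  assumes I: "ideal I R"
  shows "ideal_module_prod R M (R.ideal_pow I k) (ideal_module_prod R M (R.ideal_pow I d) (carrier M))
    \<subseteq> ideal_module_prod R M (R.ideal_pow I (k + d)) (carrier M)" (is "_ \<subseteq> ?H")
proof -
  have c: "R.ideal_pow I n \<subseteq> carrier R" for n using R.ideal_pow_carrier[OF I] by blast
  have H: "submodule ?H R M" by (intro ideal_module_prod_submodule c) auto
  have "a \<odot>\<^bsub>M\<^esub> h \<in> ?H" if a: "a \<in> R.ideal_pow I k"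
    and h: "h \<in> ideal_module_prod R M (R.ideal_pow I d) (carrier M)" for a h
  proof -
    have ac: "a \<in> carrier R" using a c by blast
    have "ideal_module_prod R M (R.ideal_pow I d) (carrier M) \<subseteq> {h \<in> carrier M. a \<odot>\<^bsub>M\<^esub> h \<in> ?H}"
      unfolding ideal_module_prod_def[of _ _ "R.ideal_pow I d"]
    proof (rule module_span_least[OF submodule_vimage_smult[OF H ac]], clarify)
      fix b g assume b: "b \<in> R.ideal_pow I d" and g: "g \<in> carrier M"
      have bc: "b \<in> carrier R" using b c by blast
      have "(a \<otimes> b) \<odot>\<^bsub>M\<^esub> g \<in> ?H" by (intro ideal_module_prod_elem R.ideal_pow_mult I a b g)
      then show "b \<odot>\<^bsub>M\<^esub> g \<in> carrier M \<and> a \<odot>\<^bsub>M\<^esub> (b \<odot>\<^bsub>M\<^esub> g) \<in> ?H"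
        using ac bc g by (simp add: smult_assoc1)
    qed
    then show ?thesis using h by blast
  qed
  then show ?thesis
    unfolding ideal_module_prod_def[of _ _ "R.ideal_pow I k"] by (intro module_span_least[OF H]) auto
qed

text \<open>Since \<open>(a z) h = a (z h)\<close>, the factor \<open>a\<close> comes out of every
  generator. Each element of \<open>J M\<close> is then one multiple \<open>a w\<close> instead of a
  sum, the form to which the cancellation modulo \<open>N\<close> applies.\<close>

lemma ideal_module_prod_reduction:
  assumes I: "ideal I R" and a: "a \<in> carrier R" and J: "J \<subseteq> (\<lambda>z. a \<otimes> z) ` R.ideal_pow I e"
  shows "ideal_module_prod R M J (carrier M)
    \<subseteq> (\<lambda>w. a \<odot>\<^bsub>M\<^esub> w) ` ideal_module_prod R M (R.ideal_pow I e) (carrier M)" (is "_ \<subseteq> _ ` ?H")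
proof -
  have c: "R.ideal_pow I n \<subseteq> carrier R" for n using R.ideal_pow_carrier[OF I] by blast
  have H: "submodule ?H R M" by (intro ideal_module_prod_submodule c) auto
  show ?thesis
    unfolding ideal_module_prod_def[of _ _ J]
  proof (rule module_span_least[OF submodule_image_smult[OF H a]], clarify)
    fix b h assume "b \<in> J" and h: "h \<in> carrier M"
    then obtain z where z: "z \<in> R.ideal_pow I e" "b = a \<otimes> z" using J by blast
    have "b \<odot>\<^bsub>M\<^esub> h = a \<odot>\<^bsub>M\<^esub> (z \<odot>\<^bsub>M\<^esub> h)" unfolding z(2) using z(1) c a h by (intro smult_assoc1) auto
    then show "b \<odot>\<^bsub>M\<^esub> h \<in> (\<lambda>w. a \<odot>\<^bsub>M\<^esub> w) ` ?H" using ideal_module_prod_elem[OF z(1) h] by blast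
  qed
qed

end

section \<open>The Artin-Rees equality from exponent \<open>d\<close> on\<close>

theorem theorem8p1:
  fixes A :: "('a, 'm) ring_scheme"
    and M :: "('a, 'b, 'n) module_scheme"
    and N :: "'b set"
    and I :: "'a set"
    and d n :: nat
  assumes "cring A" and "noetherian_ring A" and "contains_rationals A"
    and "integral_degree A = enat d"
    and "module A M" and "finitely_generated_module A M"
    and "submodule N A M" and "finitely_generated_module A (M\<lparr>carrier := N\<rparr>)"
    and "regular_ideal A I"
    and "\<exists>J x. principal_reduction A J I \<and> J = Idl\<^bsub>A\<^esub> {x} \<and>
           d_sequence A (quotient_module A M N) [x]"
    and "n \<ge> d"
  shows "ideal_module_prod A M (I [^]\<^bsub>ideals_set A\<^esub> n) (carrier M) \<inter> N =
         ideal_module_prod A M (I [^]\<^bsub>ideals_set A\<^esub> (n - d))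
           (ideal_module_prod A M (I [^]\<^bsub>ideals_set A\<^esub> d) (carrier M) \<inter> N)"
proof -
  interpret module A M by fact
  note N = \<open>submodule N A M\<close>
  have I: "ideal I A" using \<open>regular_ideal A I\<close> by (simp add: regular_ideal_def)
  obtain x where red: "reduction A (Idl\<^bsub>A\<^esub> {x}) I" and dseq: "d_sequence A (quotient_module A M N) [x]"
    using assms(10) by (auto simp: principal_reduction_def)
  have x: "x \<in> carrier A"
    using dseq by (simp add: d_sequence_def)
  have xI: "x \<in> I" using red R.genideal_self'[OF x] by (auto simp: reduction_def)
  obtain e where e: "d = Suc e" "R.ideal_pow I d \<subseteq> (\<lambda>z. x \<otimes>\<^bsub>A\<^esub> z) ` R.ideal_pow I e"
    using R.reduction_number_less_integral_degree[OF assms(2-4,9) x red] .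
  define k where "k = n - d"
  \<comment> \<open>The first form extracts \<open>x^(k+1)\<close> from \<open>I^n\<close>; the
    second splits off \<open>I^(n-d)\<close>.\<close>
  have n: "n = e + Suc k" "n = k + d" using \<open>n \<ge> d\<close> e(1) by (simp_all add: k_def)
  let ?P = "\<lambda>m. ideal_module_prod A M (R.ideal_pow I m) (carrier M)"
  have c: "R.ideal_pow I m \<subseteq> carrier A" for m using R.ideal_pow_carrier[OF I] by blast
  have P: "submodule (?P m) A M" for m by (intro ideal_module_prod_submodule c) auto
  have "?P n \<inter> N \<subseteq> ideal_module_prod A M (R.ideal_pow I k) (?P d \<inter> N)"
  proof
    fix z assume z: "z \<in> ?P n \<inter> N"
    have "?P n \<subseteq> (\<lambda>w. x [^]\<^bsub>A\<^esub> Suc k \<odot>\<^bsub>M\<^esub> w) ` ?P e"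
      unfolding n(1) using x
      by (intro ideal_module_prod_reduction[OF I] R.ideal_pow_reduction[OF I x e(2)[unfolded e(1)]]) simp
    then obtain w where w: "w \<in> ?P e" "z = x [^]\<^bsub>A\<^esub> Suc k \<odot>\<^bsub>M\<^esub> w" using z by blast
    have wc: "w \<in> carrier M" using w(1) submoduleE(1)[OF P] by blast
    have "x \<odot>\<^bsub>M\<^esub> w \<in> N" using d_sequence_quotient_cancel[OF N dseq wc] z w(2) by blast
    \<comment> \<open>One factor \<open>x\<close> stays with \<open>w\<close>: it lifts
      \<open>I^(d-1) M\<close> to \<open>I^d M\<close> and is the factor that cancellation modulo
      \<open>N\<close> cannot remove.\<close>
    moreover have "x \<odot>\<^bsub>M\<^esub> w \<in> ?P d"
    proof -
      have "x \<odot>\<^bsub>M\<^esub> w \<in> ideal_module_prod A M (R.ideal_pow I (Suc 0)) (?P e)"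
        using xI w(1) by (intro ideal_module_prod_elem) (simp_all only: R.ideal_pow_1[OF I])
      then show ?thesis using ideal_module_prod_pow_subset[OF I, of "Suc 0" e] e(1) by auto
    qed
    moreover have "z = x [^]\<^bsub>A\<^esub> k \<odot>\<^bsub>M\<^esub> (x \<odot>\<^bsub>M\<^esub> w)" unfolding w(2) using x wc by (simp add: smult_assoc1)
    ultimately show "z \<in> ideal_module_prod A M (R.ideal_pow I k) (?P d \<inter> N)"
      using R.ideal_pow_elem[OF I xI] by (auto intro: ideal_module_prod_elem)
  qed
  moreover have "ideal_module_prod A M (R.ideal_pow I k) (?P d \<inter> N) \<subseteq> N"
    unfolding ideal_module_prod_def[of _ _ "R.ideal_pow I k"]
    using c submoduleE(4)[OF N] by (intro module_span_least[OF N]) auto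
  moreover have "ideal_module_prod A M (R.ideal_pow I k) (?P d \<inter> N) \<subseteq> ?P n"
  proof -
    have "ideal_module_prod A M (R.ideal_pow I k) (?P d \<inter> N) \<subseteq> ideal_module_prod A M (R.ideal_pow I k) (?P d)"
      unfolding ideal_module_prod_def[of _ _ "R.ideal_pow I k"] module_span_def by blast
    also have "\<dots> \<subseteq> ?P n" unfolding n(2) by (rule ideal_module_prod_pow_subset[OF I])
    finally show ?thesis .
  qed
  ultimately show ?thesis unfolding k_def by blast
qed

end
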